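(* Let $t\ge 17$ be an odd integer, put $n=5t-10$, and define $$S_t=\{t-4,\,t-3\}\cup [t+1,(3t-9)/2]_{\mathbb Z}\cup\{(3t-5)/2,\,2t-4\}.$$ Then the circulant graph $G_t=\operatorname{Circ}(n,S_t)$ is doubly saturated $R(3,t)$-good. More precisely: (1) $G_t$ is triangle-free. (2) $\alpha(G_t)=t-1$, where $\alpha$ denotes the independence number. (3) Adding any nonedge to $G_t$ creates a triangle. (4) Deleting any edge from $G_t$ creates an independent set of order $t$.
   Context: Graphs are finite and simple. For integers $a\le b$, $[a,b]_{\mathbb Z}=\{a,a+1,\dots,b\}$. For $n\ge 3$ and $S\subseteq\{1,\dots,\lfloor n/2\rfloor\}$, $\operatorname{Circ}(n,S)$ is the graph with vertex set $\mathbb Z/n\mathbb Z$ in which $x$ and $y$ are adjacent exactly when their least circular distance belongs to $S$ (the least circular distance of $x,y$ is $\min(k,n-k)$, where $k\in\{0,\dots,n-1\}$ represents $y-x$ modulo $n$). A graph is $R(s,t)$-good if it contains neither a clique of order $s$ nor an independent set of order $t$. It is doubly saturated $R(s,t)$-good if it is $R(s,t)$-good, adding any missing edge destroys that property, and deleting any existing edge also destroys that property. *)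

theory Defs
  imports "HOL-Library.Ramsey"
begin

text \<open>
  A graph is a pair of a vertex set and a set of edges, the edges being two-element sets of
  vertices as in \<^const>\<open>clique\<close> and \<^const>\<open>indep\<close> of the library theory on Ramsey's theorem.
\<close>

type_synonym 'a ugraph = "'a set \<times> 'a set set"

abbreviation vertices :: "'a ugraph \<Rightarrow> 'a set" where
  "vertices \<equiv> fst"

abbreviation edges :: "'a ugraph \<Rightarrow> 'a set set" where
  "edges \<equiv> snd"

definition finite_simple_graph :: "'a ugraph \<Rightarrow> bool" where
  "finite_simple_graph G \<longleftrightarrow> finite (vertices G) \<and> edges G \<subseteq> [vertices G]\<^bsup>2\<^esup>"

definition nonedges :: "'a ugraph \<Rightarrow> 'a set set" where
  "nonedges G = [vertices G]\<^bsup>2\<^esup> - edges G"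

definition add_edge :: "'a ugraph \<Rightarrow> 'a set \<Rightarrow> 'a ugraph" where
  "add_edge G e = (vertices G, insert e (edges G))"

definition del_edge :: "'a ugraph \<Rightarrow> 'a set \<Rightarrow> 'a ugraph" where
  "del_edge G e = (vertices G, edges G - {e})"

definition has_clique :: "'a ugraph \<Rightarrow> nat \<Rightarrow> bool" where
  "has_clique G s \<longleftrightarrow> (\<exists>K \<subseteq> vertices G. finite K \<and> card K = s \<and> clique K (edges G))"

definition has_indep :: "'a ugraph \<Rightarrow> nat \<Rightarrow> bool" where
  "has_indep G t \<longleftrightarrow> (\<exists>I \<subseteq> vertices G. finite I \<and> card I = t \<and> indep I (edges G))"

abbreviation has_triangle :: "'a ugraph \<Rightarrow> bool" where
  "has_triangle G \<equiv> has_clique G 3"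

definition independence_number :: "'a ugraph \<Rightarrow> nat" where
  "independence_number G = Max {card I | I. I \<subseteq> vertices G \<and> indep I (edges G)}"

definition R_good :: "nat \<Rightarrow> nat \<Rightarrow> 'a ugraph \<Rightarrow> bool" where
  "R_good s t G \<longleftrightarrow> \<not> has_clique G s \<and> \<not> has_indep G t"

definition doubly_saturated_R_good :: "nat \<Rightarrow> nat \<Rightarrow> 'a ugraph \<Rightarrow> bool" where
  "doubly_saturated_R_good s t G \<longleftrightarrow>
     R_good s t G \<and>
     (\<forall>e \<in> nonedges G. \<not> R_good s t (add_edge G e)) \<and>
     (\<forall>e \<in> edges G. \<not> R_good s t (del_edge G e))"

definition circ_dist :: "int \<Rightarrow> int \<Rightarrow> int \<Rightarrow> int" where
  "circ_dist n x y = (let k = (y - x) mod n in min k (n - k))"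

text \<open>
  The integers modulo \<open>n\<close> are represented by their least nonnegative residues. The definition
  is meant for \<open>n \<ge> 3\<close> and \<open>S \<subseteq> {1..n div 2}\<close>; in particular \<open>0 \<notin> S\<close> excludes loops.
\<close>

definition Circ :: "int \<Rightarrow> int set \<Rightarrow> int ugraph" where
  "Circ n S =
     ({0..<n}, {{x, y} | x y. x \<in> {0..<n} \<and> y \<in> {0..<n} \<and> circ_dist n x y \<in> S})"

lemma circ_dist_commute: "circ_dist n x y = circ_dist n y x" if "n > 0"
proof -
  have "(y - x) mod n = (if (x - y) mod n = 0 then 0 else n - (x - y) mod n)"
    using zmod_zminus1_eq_if[of "x - y" n] by simp
  then show ?thesis
    using that by (auto simp: circ_dist_def Let_def min_def)
qed

lemma finite_simple_graph_Circ:
  assumes "n \<ge> 3" "S \<subseteq> {1..n div 2}"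
  shows "finite_simple_graph (Circ n S)"
  using assms by (auto simp: finite_simple_graph_def Circ_def circ_dist_def)

lemma Circ_adjacent_iff:
  assumes "n \<ge> 3" "x \<in> {0..<n}" "y \<in> {0..<n}"
  shows "{x, y} \<in> edges (Circ n S) \<longleftrightarrow> circ_dist n x y \<in> S"
  using assms circ_dist_commute[of n x y] by (auto simp: Circ_def doubleton_eq_iff)

text \<open>Both divisions by 2 are exact, as \<open>t\<close> is odd.\<close>

definition S_set :: "int \<Rightarrow> int set" where
  "S_set t =
     {t - 4, t - 3} \<union> {t + 1..(3 * t - 9) div 2} \<union> {(3 * t - 5) div 2, 2 * t - 4}"

definition G_graph :: "int \<Rightarrow> int ugraph" where
  "G_graph t = Circ (5 * t - 10) (S_set t)"

lemma S_set_subset: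
  assumes "t \<ge> 17"
  shows "S_set t \<subseteq> {1..(5 * t - 10) div 2}"
  using assms by (auto simp: S_set_def)

end

theory Submission
  imports Defs
begin

text \<open>
  Write \<open>t = 2h + 3\<close> and \<open>u = 2h + 1\<close>, so that \<open>n = 5u\<close>. Since \<open>2u \<in> S\<^sub>t\<close>, the coset \<open>r + u\<int>\<close>
  (the fibre of \<open>r\<close>) induces a 5-cycle, so an independent set \<open>I\<close> meets it in at most two points, and
  if in two, then in a pair \<open>x, x + u\<close> (a double). If \<open>|I| \<ge> u + 2\<close>, averaging over windows of
  \<open>h + 1\<close> consecutive fibres gives a window with at least two more doubles than empty fibres, hence
  two doubles at distance \<open>d \<le> h\<close> with no empty fibre in between. For \<open>6 \<le> d < h\<close> the nonempty
  fibres in between are contradictory. In each of the twelve remaining configurations the common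
  non-neighbours of the two doubles are covered by edges, single vertices and 5-cycles, which bounds
  \<open>|I|\<close> by \<open>u + 1\<close> after all. This is the upper bound for the independence number; it is attained by
  a neighbourhood. The connection set is sum-free, every other nonzero residue is a sum of two of its
  elements, and for every element \<open>s\<close> of it there is an explicit set of order \<open>u + 2\<close> spanning only
  the edge \<open>{0, s}\<close>.
\<close>

section \<open>The connection set and independent sets\<close>

text \<open>The symmetric closure modulo \<open>n = 10h + 5\<close> of the set \<open>S\<^sub>t\<close>.\<close>

definition conn :: "int \<Rightarrow> int set" where
  "conn h = {2*h-1..2*h} \<union> {2*h+4..3*h} \<union> {3*h+2} \<union> {4*h+2} \<union>
     {6*h+3} \<union> {7*h+3} \<union> {7*h+5..8*h+1} \<union> {8*h+5..8*h+6}"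

lemma conn_iff:
  "z \<in> conn h \<longleftrightarrow> (2*h-1 \<le> z \<and> z \<le> 2*h) \<or> (2*h+4 \<le> z \<and> z \<le> 3*h) \<or> z = 3*h+2 \<or> z = 4*h+2 \<or>
     z = 6*h+3 \<or> z = 7*h+3 \<or> (7*h+5 \<le> z \<and> z \<le> 8*h+1) \<or> (8*h+5 \<le> z \<and> z \<le> 8*h+6)"
  by (auto simp: conn_def)

text \<open>
  Independent sets are viewed as \<open>n\<close>-periodic sets of integers, which makes them closed under
  translation. By periodicity and symmetry it suffices to test differences without reduction.
\<close>

definition periodic_indep :: "int \<Rightarrow> (int \<Rightarrow> bool) \<Rightarrow> bool" where
  "periodic_indep h P \<longleftrightarrow> (\<forall>x. P (x + (10*h+5)) = P x) \<and> (\<forall>x y. P x \<longrightarrow> P y \<longrightarrow> x - y \<notin> conn h)"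

definition period_set :: "int \<Rightarrow> (int \<Rightarrow> bool) \<Rightarrow> int set" where
  "period_set h P = {x \<in> {0..<10*h+5}. P x}"

lemma periodic_indepD: "periodic_indep h P \<Longrightarrow> P x \<Longrightarrow> P y \<Longrightarrow> x - y \<notin> conn h"
  by (simp add: periodic_indep_def)

lemma periodic_indep_shift [simp]: "periodic_indep h P \<Longrightarrow> P (x + (10*h+5)) = P x"
  by (simp add: periodic_indep_def)

lemma finite_period_set [simp]: "finite (period_set h P)"
  by (auto simp: period_set_def intro: finite_subset[of _ "{0..<10*h+5}"])

section \<open>Coverings by blocks, tilings and 5-cycles\<close>

text \<open>
  For \<open>k\<close> in the connection set, a block is a union of the \<open>b - a + 1\<close> edges \<open>{x, x + k}\<close>; for \<open>k = 0\<close>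
  it consists of single vertices.
\<close>

abbreviation pair_block :: "int \<times> int \<times> int \<Rightarrow> int set" where
  "pair_block \<equiv> \<lambda>(a, b, k). {a..b} \<union> {a+k..b+k}"

text \<open>Translation by \<open>-k\<close> moves the upper half into \<open>{a..b}\<close>, and
  independence keeps its image disjoint from the lower half because \<open>x\<close> and
  \<open>x + k\<close> are adjacent.\<close>

lemma card_pair_block_le:
  assumes k: "k = 0 \<or> k \<in> conn h" and I: "\<And>x y. x \<in> I \<Longrightarrow> y \<in> I \<Longrightarrow> x - y \<notin> conn h"
  shows "int (card (I \<inter> pair_block (a, b, k))) \<le> max 0 (b - a + 1)"
proof -
  let ?U = "I \<inter> {a..b}" and ?V = "(\<lambda>x. x - k) ` (I \<inter> {a+k..b+k})"
  have "card (I \<inter> pair_block (a, b, k)) \<le> card {a..b}"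
  proof (cases "k = 0")
    case True
    then show ?thesis by (auto intro!: card_mono simp del: card_atLeastAtMost_int)
  next
    case False
    have "card (I \<inter> pair_block (a, b, k)) \<le> card ?U + card (I \<inter> {a+k..b+k})"
      using card_Un_le[of ?U "I \<inter> {a+k..b+k}"] by (simp add: Int_Un_distrib)
    also have "card (I \<inter> {a+k..b+k}) = card ?V"
      by (simp add: card_image inj_on_def)
    also have "card ?U + card ?V = card (?U \<union> ?V)"
    proof (rule card_Un_disjoint[symmetric])
      show "?U \<inter> ?V = {}"
        using I[of "x + k" x for x] k False by force
    qed auto
    also have "\<dots> \<le> card {a..b}"
      by (rule card_mono) auto
    finally show ?thesis .
  qed
  then show ?thesis by simp
qed

lemma card_le_cover:
  assumes "finite I" "\<And>x y. x \<in> I \<Longrightarrow> y \<in> I \<Longrightarrow> x - y \<notin> conn h"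
    and "\<forall>(a, b, k) \<in> set bs. k = 0 \<or> k \<in> conn h"
    and "\<And>x. x \<in> I \<Longrightarrow> \<exists>B\<in>set bs. x \<in> pair_block B"
  shows "int (card I) \<le> (\<Sum>(a, b, k)\<leftarrow>bs. max 0 (b - a + 1))"
  using assms
proof (induction bs arbitrary: I)
  case Nil
  then have "I = {}" by auto
  then show ?case by simp
next
  case (Cons B bs)
  obtain a b k where B: "B = (a, b, k)" by (cases B)
  have "card I \<le> card (I \<inter> pair_block B) + card (I - pair_block B)"
    using card_Un_le[of "I \<inter> pair_block B" "I - pair_block B"] by (simp add: Int_Diff_Un)
  moreover have "int (card (I - pair_block B)) \<le> (\<Sum>(a, b, k)\<leftarrow>bs. max 0 (b - a + 1))"
    using Cons.prems by (intro Cons.IH) auto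
  moreover have "int (card (I \<inter> pair_block B)) \<le> max 0 (b - a + 1)"
    unfolding B using Cons.prems(2,3) by (intro card_pair_block_le) (auto simp: B)
  ultimately show ?case by (simp add: B)
qed

text \<open>The list form lets a tiling cell name a run of the connection set by its index.
  Reflection of z to n - z exchanges the indices \<open>j\<close> and \<open>7 - j\<close>.\<close>

definition conn_ranges :: "int \<Rightarrow> (int \<times> int) list" where
  "conn_ranges h = [(2*h-1, 2*h), (2*h+4, 3*h), (3*h+2, 3*h+2), (4*h+2, 4*h+2),
     (6*h+3, 6*h+3), (7*h+3, 7*h+3), (7*h+5, 8*h+1), (8*h+5, 8*h+6)]"

lemma conn_ranges: "(p, q) \<in> set (conn_ranges h) \<Longrightarrow> p \<le> z \<Longrightarrow> z \<le> q \<Longrightarrow> z \<in> conn h"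
  by (auto simp: conn_ranges_def conn_iff)

text \<open>
  A tiling certifies that blocks cover all common non-neighbours of the vertices \<open>cs\<close>. It lists
  intervals whose union is a whole period, each of them contained in one half of a block
  (\<open>Low\<close>, \<open>High\<close>) or in the neighbourhood of a vertex \<open>c\<close> (\<open>Right\<close>: to the right of \<open>c\<close>, \<open>Left\<close>: to
  its left). Only the order of the endpoints has to be checked, by linear arithmetic in \<open>h\<close>.
\<close>

datatype cell = Low nat | High nat | Right nat nat | Left nat nat

fun cell_range :: "int \<Rightarrow> (int \<times> int \<times> int) list \<Rightarrow> int list \<Rightarrow> cell \<Rightarrow> int \<times> int" where
  "cell_range h bs cs (Low i) = (case bs ! i of (a, b, k) \<Rightarrow> (a, b))"
| "cell_range h bs cs (High i) = (case bs ! i of (a, b, k) \<Rightarrow> (a + k, b + k))"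
| "cell_range h bs cs (Right i j) = (case conn_ranges h ! j of (p, q) \<Rightarrow> (cs ! i + p, cs ! i + q))"
| "cell_range h bs cs (Left i j) = (case conn_ranges h ! j of (p, q) \<Rightarrow> (cs ! i - q, cs ! i - p))"

fun cell_valid :: "(int \<times> int \<times> int) list \<Rightarrow> int list \<Rightarrow> cell \<Rightarrow> bool" where
  "cell_valid bs cs (Low i) \<longleftrightarrow> i < length bs"
| "cell_valid bs cs (High i) \<longleftrightarrow> i < length bs"
| "cell_valid bs cs (Right i j) \<longleftrightarrow> i < length cs \<and> j < 8"
| "cell_valid bs cs (Left i j) \<longleftrightarrow> i < length cs \<and> j < 8"

fun tiling :: "int \<Rightarrow> (int \<times> int \<times> int) list \<Rightarrow> int list \<Rightarrow> int \<Rightarrow> cell list \<Rightarrow> bool" where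
  "tiling h bs cs l [] \<longleftrightarrow> 10*h+5 \<le> l"
| "tiling h bs cs l (c # ts) \<longleftrightarrow> cell_valid bs cs c \<and>
     (case cell_range h bs cs c of (a, b) \<Rightarrow> a \<le> l \<and> tiling h bs cs (b + 1) ts)"

text \<open>Everything from \<open>l\<close> on remains to be covered, so a point not beyond the
  current cell lies in it. \<open>Right\<close> and \<open>Left\<close> cells contain no point of
  \<open>P\<close>, since their vertices satisfy \<open>P\<close>; only blocks remain.\<close>

lemma tiling_cover:
  assumes P: "periodic_indep h P" "\<forall>c\<in>set cs. P c"
    and "tiling h bs cs l ts" "l \<le> x" "x < 10*h+5" "P x"
  shows "\<exists>B\<in>set bs. x \<in> pair_block B"
  using assms(3-)
proof (induction ts arbitrary: l)
  case Nil
  then show ?case by simp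
next
  case (Cons c ts)
  obtain a b where ab: "cell_range h bs cs c = (a, b)" by fastforce
  show ?case
  proof (cases "b < x")
    case True
    then show ?thesis using Cons.prems ab by (intro Cons.IH[of "b + 1"]) auto
  next
    case False
    then have x: "a \<le> x" "x \<le> b" and c: "cell_valid bs cs c"
      using Cons.prems ab by auto
    have block: ?thesis if "i < length bs" "x \<in> pair_block (bs ! i)" for i
      using that(2) nth_mem[OF that(1)] by (rule bexI)
    have conn_bounds: "x - cs ! i \<notin> {p..q}" "cs ! i - x \<notin> {p..q}"
      if "i < length cs" "j < 8" "conn_ranges h ! j = (p, q)" for i j p q
    proof -
      have "P (cs ! i)" "(p, q) \<in> set (conn_ranges h)"
        using that P(2) nth_mem[of j "conn_ranges h"] by (auto simp: conn_ranges_def)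
      then show "x - cs ! i \<notin> {p..q}" "cs ! i - x \<notin> {p..q}"
        using periodic_indepD[OF P(1)] Cons.prems(4) conn_ranges[of p q h] by (meson atLeastAtMost_iff)+
    qed
    show ?thesis
    proof (cases c)
      case (Low i)
      obtain a' b' k where "bs ! i = (a', b', k)" by (cases "bs ! i")
      then show ?thesis using ab x c Low by (intro block[of i]) auto
    next
      case (High i)
      obtain a' b' k where "bs ! i = (a', b', k)" by (cases "bs ! i")
      then show ?thesis using ab x c High by (intro block[of i]) auto
    next
      case (Right i j)
      obtain p q where "conn_ranges h ! j = (p, q)" by fastforce
      then show ?thesis using ab x c Right conn_bounds(1)[of i j p q] by auto
    next
      case (Left i j)
      obtain p q where "conn_ranges h ! j = (p, q)" by fastforce
      then show ?thesis using ab x c Left conn_bounds(2)[of i j p q] by auto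
    qed
  qed
qed

definition five_cycle :: "int \<Rightarrow> int list \<Rightarrow> bool" where
  "five_cycle h zs \<longleftrightarrow> length zs = 5 \<and>
     (\<forall>i<5. zs ! i - zs ! ((i + 1) mod 5) \<in> conn h \<or> zs ! ((i + 1) mod 5) - zs ! i \<in> conn h)"

text \<open>A 5-cycle has independence number 2. Counting positions of the list leaves a
  propositional check of five adjacencies.\<close>

lemma card_five_cycle_le:
  assumes "five_cycle h zs" and I: "\<And>x y. x \<in> I \<Longrightarrow> y \<in> I \<Longrightarrow> x - y \<notin> conn h"
  shows "card (I \<inter> set zs) \<le> 2"
proof -
  have len: "length zs = Suc (Suc (Suc (Suc (Suc 0))))"
    using assms(1) by (simp add: five_cycle_def)
  then obtain v w x y z where zs: "zs = [v, w, x, y, z]"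
    by (auto simp: length_Suc_conv)
  have adj: "zs ! i \<notin> I \<or> zs ! ((i + 1) mod 5) \<notin> I" if "i < 5" for i
    using assms(1) I that unfolding five_cycle_def by blast
  have "card (I \<inter> set zs) \<le> length (filter (\<lambda>v. v \<in> I) zs)"
    using card_length[of "filter (\<lambda>v. v \<in> I) zs"] by (simp add: Int_def conj_commute)
  also have "\<dots> \<le> 2"
    using adj[of 0] adj[of 1] adj[of 2] adj[of 3] adj[of 4] by (auto simp: zs)
  finally show ?thesis .
qed

text \<open>Each 5-cycle is removed at a cost of 2. Its vertices enter the covering condition as
  degenerate blocks, so that a tiling can name them by \<open>Low\<close>, but the bound charges
  only the cycle.\<close>

lemma card_le_cycles_blocks:
  assumes "finite I" and I: "\<And>x y. x \<in> I \<Longrightarrow> y \<in> I \<Longrightarrow> x - y \<notin> conn h"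
    and "\<forall>zs \<in> set zss. five_cycle h zs"
    and "\<forall>(a, b, k) \<in> set bs. k = 0 \<or> k \<in> conn h"
    and "\<And>x. x \<in> I \<Longrightarrow> \<exists>B\<in>set (map (\<lambda>z. (z, z, 0)) (concat zss) @ bs). x \<in> pair_block B"
  shows "int (card I) \<le> 2 * int (length zss) + (\<Sum>(a, b, k)\<leftarrow>bs. max 0 (b - a + 1))"
  using assms
proof (induction zss arbitrary: I)
  case Nil
  then show ?case using card_le_cover[of I h bs] by simp
next
  case (Cons zs zss)
  have "card I \<le> card (I \<inter> set zs) + card (I - set zs)"
    using card_Un_le[of "I \<inter> set zs" "I - set zs"] by (simp add: Int_Diff_Un)
  moreover have "card (I \<inter> set zs) \<le> 2"
    using Cons.prems(2,3) by (intro card_five_cycle_le) auto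
  moreover have "int (card (I - set zs)) \<le> 2 * int (length zss) + (\<Sum>(a, b, k)\<leftarrow>bs. max 0 (b - a + 1))"
  proof (rule Cons.IH)
    fix x assume "x \<in> I - set zs"
    then show "\<exists>B\<in>set (map (\<lambda>z. (z, z, 0)) (concat zss) @ bs). x \<in> pair_block B"
      using Cons.prems(5)[of x] by auto
  qed (use Cons.prems in auto)
  ultimately show ?case by simp
qed

lemma card_period_set_le:
  assumes P: "periodic_indep h P" "\<forall>c\<in>set cs. P c"
    and tiling: "tiling h (map (\<lambda>z. (z, z, 0)) (concat zss) @ bs) cs 0 ts"
    and zss: "\<forall>zs \<in> set zss. five_cycle h zs"
    and bs: "\<forall>(a, b, k) \<in> set bs. k = 0 \<or> k \<in> conn h"
  shows "int (card (period_set h P)) \<le> 2 * int (length zss) + (\<Sum>(a, b, k)\<leftarrow>bs. max 0 (b - a + 1))"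
proof (rule card_le_cycles_blocks[OF finite_period_set _ zss bs])
  fix x y assume "x \<in> period_set h P" "y \<in> period_set h P"
  then show "x - y \<notin> conn h" using periodic_indepD[OF P(1)] by (simp add: period_set_def)
next
  fix x assume "x \<in> period_set h P"
  then show "\<exists>B\<in>set (map (\<lambda>z. (z, z, 0)) (concat zss) @ bs). x \<in> pair_block B"
    using tiling_cover[OF P tiling, of x] by (simp add: period_set_def)
qed

section \<open>Covers for two doubles\<close>

lemma all_less_5: "(\<forall>i<5. Q i) \<longleftrightarrow> Q 0 \<and> Q (1::nat) \<and> Q 2 \<and> Q 3 \<and> Q 4"
  by (auto simp: less_Suc_eq eval_nat_numeral)

text \<open>
  In \<open>card_period_set_le_d_q\<close> the doubles start at \<open>0\<close> and at \<open>d + q(2h + 1)\<close>. The covers come from a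
  computer search for maximum matchings in the graph of common non-neighbours, uniformly in \<open>h\<close>;
  in three configurations the uniform pattern starts only at \<open>h = 8\<close>, so \<open>h = 7\<close> needs its own cover.
  A 5-cycle is needed where a matching bound is too weak by one.
\<close>

lemma card_period_set_le_1_1:
  assumes "periodic_indep h P" "h \<ge> 7" "P 0" "P (2*h+1)" "P (2*h+2)" "P (4*h+3)"
  shows "int (card (period_set h P)) \<le> 2*h+2"
proof -
  let ?cs = "[0, 2*h+1, 2*h+2, 4*h+3]"
  let ?zss = "[[h+2, 3*h+1, 10*h+4, 7*h+4, 4*h+4]] :: int list list"
  \<comment> \<open>The four points of the doubles, two ladders of \<open>h - 5\<close> edges each,
    and six single edges; with the cycle this makes 2 + 4 + 2(h - 5) + 6 = 2h + 2.\<close>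
  let ?bs =
    "[(0, 0, 0), (2*h+1, 2*h+1, 0), (2*h+2, 2*h+2, 0), (4*h+3, 4*h+3, 0), (4, h-2, 8*h+5),
    (3*h+5, 4*h-1, 2*h), (h-1, h-1, 7*h+3), (h, h, 7*h+3), (3*h+3, 3*h+3, 3*h+2),
    (3*h+4, 3*h+4, 3*h+2), (6*h, 6*h, 2*h+7), (6*h+1, 6*h+1, 2*h+7)]"
  \<comment> \<open>Indices 0 to 4 are the vertices of the 5-cycle; the blocks of \<open>?bs\<close>
    are numbered from 5.\<close>
  let ?ts =
    "[Low 5, Left 1 0, Left 2 0, Low 9, Low 11, Low 12, Left 3 2, Low 0, Left 3 1, Right 0 0,
    Low 6, Low 7, Left 3 0, Right 0 1, Low 1, Right 0 2, Low 13, Low 14, Low 10, Right 1 0,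
    Right 0 3, Low 8, Low 4, Right 1 1, Right 2 1, Right 1 2, Right 2 2, High 10, Low 15, Low 16,
    Right 3 0, Right 2 3, High 13, High 14, Right 3 1, Low 3, Right 0 6, High 11, High 12,
    Right 1 4, Right 0 7, High 15, High 16, High 9, Right 1 5, Right 2 5, Right 1 6, Right 2 6,
    Low 2]"
  have cs: "\<forall>c\<in>set ?cs. P c"
    using assms by simp
  have ts: "tiling h (map (\<lambda>z. (z, z, 0)) (concat ?zss) @ ?bs) ?cs 0 ?ts"
    using assms(2) by (simp add: conn_ranges_def)
  have zss: "\<forall>zs \<in> set ?zss. five_cycle h zs"
    using assms(2) by (simp add: five_cycle_def all_less_5 conn_iff)
  have "\<forall>(a, b, k) \<in> set ?bs. k = 0 \<or> k \<in> conn h"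
    using assms(2) by (simp add: conn_iff)
  from card_period_set_le[OF assms(1) cs ts zss this]
  show ?thesis
    using assms(2) by (simp add: max_def split: if_splits)
qed

lemma card_period_set_le_1_2:
  assumes "periodic_indep h P" "h \<ge> 7" "P 0" "P (2*h+1)" "P (4*h+3)" "P (6*h+4)"
  shows "int (card (period_set h P)) \<le> 2*h+2"
proof -
  let ?cs = "[0, 2*h+1, 4*h+3, 6*h+4]"
  let ?zss = "[] :: int list list"
  let ?bs =
    "[(0, 0, 0), (2*h+1, 2*h+1, 0), (4*h+3, 4*h+3, 0), (6*h+4, 6*h+4, 0), (4, h-2, 0),
    (5*h+6, 6*h-2, 0), (3, 3, 6*h+3), (h-1, h-1, 2*h+4), (h, h, 4*h+2), (h+2, h+2, 4*h+2),
    (3*h+1, 3*h+1, 3*h-2), (5*h+5, 5*h+5, 3*h-3), (6*h, 6*h, 2*h+7), (6*h+1, 6*h+1, 4*h+2),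
    (6*h+5, 6*h+5, 3*h), (7*h+4, 7*h+4, 3*h)]"
  let ?ts =
    "[Low 0, Left 1 0, Low 6, Low 4, Low 7, Low 8, Left 2 2, Low 9, Left 2 1, Right 0 0, Low 1,
    Left 3 3, Left 2 0, Right 0 1, Low 10, Right 0 2, High 7, Left 3 1, Right 1 0, Right 0 3,
    Low 2, Left 3 0, Right 1 1, High 8, Right 1 2, High 9, Low 11, Low 5, High 10, Low 12, Low 13,
    Right 2 0, Low 3, Low 14, High 6, Right 2 1, Low 15, Right 0 6, High 11, Right 3 0, Right 0 7,
    High 12, Right 3 1, High 14, Right 1 6, High 13, High 15]"
  have cs: "\<forall>c\<in>set ?cs. P c"
    using assms by simp
  have ts: "tiling h (map (\<lambda>z. (z, z, 0)) (concat ?zss) @ ?bs) ?cs 0 ?ts"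
    using assms(2) by (simp add: conn_ranges_def)
  have zss: "\<forall>zs \<in> set ?zss. five_cycle h zs"
    using assms(2) by simp
  have "\<forall>(a, b, k) \<in> set ?bs. k = 0 \<or> k \<in> conn h"
    using assms(2) by (simp add: conn_iff)
  from card_period_set_le[OF assms(1) cs ts zss this]
  show ?thesis
    using assms(2) by (simp add: max_def split: if_splits)
qed

lemma card_period_set_le_2_1:
  assumes "periodic_indep h P" "h \<ge> 7" "P 0" "P (2*h+1)" "P (2*h+3)" "P (4*h+4)"
  shows "int (card (period_set h P)) \<le> 2*h+2"
proof -
  let ?cs = "[0, 2*h+1, 2*h+3, 4*h+4]"
  let ?zss = "[[2*h+2, 5*h+4, 3*h+4, 6*h+6, 9*h+5]] :: int list list"
  let ?bs =
    "[(0, 0, 0), (2*h+1, 2*h+1, 0), (2*h+3, 2*h+3, 0), (4*h+4, 4*h+4, 0), (5, h-2, 8*h+5),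
    (3*h+6, 4*h-1, 2*h), (h-1, h-1, 2*h+4), (h, h, 7*h+3), (h+1, h+1, 7*h+8), (h+3, h+3, 7*h+5),
    (3*h+1, 3*h+1, 3*h), (3*h+5, 3*h+5, 3*h+2), (6*h, 6*h, 2*h+7), (6*h+2, 6*h+2, 2*h)]"
  let ?ts =
    "[Low 5, Left 1 0, Left 2 0, Low 9, Low 11, Low 12, Low 13, Left 3 2, Low 14, Left 3 1, Low 6,
    Low 0, Low 7, Right 0 1, Low 15, Right 0 2, High 11, Low 2, Low 16, Low 10, Right 1 0,
    Right 2 0, Low 8, Right 1 1, Right 2 1, Low 1, Right 2 2, High 10, Low 17, High 15, Low 18,
    Right 3 0, Right 2 3, Low 3, High 16, Right 3 1, Right 0 6, High 18, High 12, Right 1 4,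
    Right 0 7, High 17, High 14, High 13, High 9, Right 1 5, Low 4, Right 1 6, Right 2 6]"
  have cs: "\<forall>c\<in>set ?cs. P c"
    using assms by simp
  have ts: "tiling h (map (\<lambda>z. (z, z, 0)) (concat ?zss) @ ?bs) ?cs 0 ?ts"
    using assms(2) by (simp add: conn_ranges_def)
  have zss: "\<forall>zs \<in> set ?zss. five_cycle h zs"
    using assms(2) by (simp add: five_cycle_def all_less_5 conn_iff)
  have "\<forall>(a, b, k) \<in> set ?bs. k = 0 \<or> k \<in> conn h"
    using assms(2) by (simp add: conn_iff)
  from card_period_set_le[OF assms(1) cs ts zss this]
  show ?thesis
    using assms(2) by (simp add: max_def split: if_splits)
qed

lemma card_period_set_le_2_2:
  assumes "periodic_indep h P" "h \<ge> 8" "P 0" "P (2*h+1)" "P (4*h+4)" "P (6*h+5)"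
  shows "int (card (period_set h P)) \<le> 2*h+2"
proof -
  let ?cs = "[0, 2*h+1, 4*h+4, 6*h+5]"
  let ?zss = "[] :: int list list"
  \<comment> \<open>The difference \<open>2*h+8\<close> lies in the run from \<open>2*h+4\<close> to
    \<open>3*h\<close> only for h \<ge> 8; hence the separate cover for h = 7.\<close>
  let ?bs =
    "[(0, 0, 0), (2*h+1, 2*h+1, 0), (4*h+4, 4*h+4, 0), (6*h+5, 6*h+5, 0), (5, h-4, 0),
    (5*h+7, 6*h-2, 0), (3, 3, 6*h+3), (4, 4, 6*h+3), (h-3, h-3, 2*h+7), (h-2, h-2, 7*h+5),
    (h-1, h-1, 7*h+3), (h, h, 4*h+2), (h+1, h+1, 3*h+2), (h+3, h+3, 4*h+2), (2*h+2, 2*h+2, 3*h+2),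
    (3*h+1, 3*h+1, 3*h-1), (5*h+6, 5*h+6, 3*h+2), (6*h-1, 6*h-1, 2*h+8), (6*h+1, 6*h+1, 4*h+2),
    (6*h+2, 6*h+2, 4*h+2)]"
  let ?ts =
    "[Low 0, Left 1 0, Low 6, Low 7, Low 4, Low 8, Low 9, Low 10, Low 11, Low 12, Left 2 2,
    Low 13, Left 2 1, Low 1, Low 14, Left 3 3, Right 0 1, Low 15, Right 0 2, Left 3 2, High 8,
    Left 3 1, Right 0 3, High 12, Low 2, Right 1 1, High 11, Right 1 2, High 14, High 13, Low 16,
    Low 5, Low 17, High 15, Low 18, Low 19, Right 2 0, Low 3, High 6, High 7, Right 2 1,
    Right 0 6, High 10, High 9, Right 3 0, Right 0 7, High 17, High 16, Right 3 1, Right 1 6,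
    High 18, High 19]"
  have cs: "\<forall>c\<in>set ?cs. P c"
    using assms by simp
  have ts: "tiling h (map (\<lambda>z. (z, z, 0)) (concat ?zss) @ ?bs) ?cs 0 ?ts"
    using assms(2) by (simp add: conn_ranges_def)
  have zss: "\<forall>zs \<in> set ?zss. five_cycle h zs"
    using assms(2) by simp
  have "\<forall>(a, b, k) \<in> set ?bs. k = 0 \<or> k \<in> conn h"
    using assms(2) by (simp add: conn_iff)
  from card_period_set_le[OF assms(1) cs ts zss this]
  show ?thesis
    using assms(2) by (simp add: max_def split: if_splits)
qed

lemma card_period_set_le_2_2_7:
  assumes "periodic_indep 7 P" "P 0" "P 15" "P 32" "P 47"
  shows "int (card (period_set 7 P)) \<le> 16"
proof -
  let ?cs = "[0, 15, 32, 47]"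
  \<comment> \<open>Two cycles and twelve blocks of length one give 4 + 12 = 16.\<close>
  let ?zss = "[[4, 49, 63, 42, 22], [41, 64, 43, 73, 59]] :: int list list"
  let ?bs =
    "[(0, 0, 0), (15, 15, 0), (32, 32, 0), (47, 47, 0), (3, 3, 45), (5, 5, 20), (6, 6, 52),
    (7, 7, 30), (8, 8, 23), (10, 10, 30), (16, 16, 23), (44, 44, 30)]"
  let ?ts =
    "[Low 10, Left 1 0, Low 14, Low 0, Low 15, Low 16, Low 17, Low 18, Left 2 2, Low 19, Left 2 1,
    Low 11, Low 20, Left 3 3, Right 0 1, Low 4, Right 0 2, Left 3 2, High 15, Left 3 1, Right 0 3,
    High 18, Low 12, Right 1 1, High 17, Right 1 2, High 20, High 19, Low 5, Low 3, Low 7, Low 21,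
    Right 2 0, Low 13, High 14, Low 1, Right 2 1, Right 0 6, High 16, Low 9, Right 3 0, Right 0 7,
    Low 2, Low 6, Right 3 1, Right 1 6, Low 8, High 21]"
  have cs: "\<forall>c\<in>set ?cs. P c"
    using assms by simp
  have ts: "tiling 7 (map (\<lambda>z. (z, z, 0)) (concat ?zss) @ ?bs) ?cs 0 ?ts"
    by (simp add: conn_ranges_def)
  have zss: "\<forall>zs \<in> set ?zss. five_cycle 7 zs"
    by (simp add: five_cycle_def all_less_5 conn_iff)
  have "\<forall>(a, b, k) \<in> set ?bs. k = 0 \<or> k \<in> conn 7"
    by (simp add: conn_iff)
  from card_period_set_le[OF assms(1) cs ts zss this]
  show ?thesis
    by (simp add: max_def split: if_splits)
qed

lemma card_period_set_le_3_3:
  assumes "periodic_indep h P" "h \<ge> 7" "P 0" "P (2*h+1)" "P (6*h+6)" "P (8*h+7)"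
  shows "int (card (period_set h P)) \<le> 2*h+2"
proof -
  let ?cs = "[0, 2*h+1, 6*h+6, 8*h+7]"
  let ?zss = "[] :: int list list"
  let ?bs =
    "[(0, 0, 0), (2*h+1, 2*h+1, 0), (6*h+6, 6*h+6, 0), (8*h+7, 8*h+7, 0), (6*h+9, 7*h+1, 0),
    (h+5, 2*h-3, 0), (4, 4, 8*h-2), (5, 5, 3*h-2), (h+3, h+3, 7*h+5), (2*h-2, 2*h-2, 2*h+6),
    (2*h+2, 2*h+2, 3*h), (2*h+3, 2*h+3, 2*h), (3*h+1, 3*h+1, 2*h+5), (3*h+5, 3*h+5, 2*h-1),
    (6*h+4, 6*h+4, 2*h-1), (6*h+5, 6*h+5, 2*h+4), (7*h+2, 7*h+2, 3*h+2), (7*h+4, 7*h+4, 3*h-1)]"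
  let ?ts =
    "[Low 0, Left 1 0, Left 2 4, Low 6, Low 7, Left 3 6, Low 8, Left 3 5, Low 5, Low 9, Right 0 0,
    Low 1, Low 10, Low 11, Right 0 1, Low 12, Right 0 2, High 7, Left 2 2, Low 13, Left 2 1,
    High 11, High 9, Right 1 1, High 10, Right 1 2, High 13, Left 3 2, High 12, Left 3 1, Low 14,
    Low 15, Low 2, Left 3 0, Low 4, Low 16, Right 0 5, Low 17, Right 0 6, High 6, High 14,
    Right 1 4, Right 0 7, Low 3, High 8, High 15, Right 2 1, Right 1 6, High 17, High 16]"
  have cs: "\<forall>c\<in>set ?cs. P c"
    using assms by simp
  have ts: "tiling h (map (\<lambda>z. (z, z, 0)) (concat ?zss) @ ?bs) ?cs 0 ?ts"
    using assms(2) by (simp add: conn_ranges_def)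
  have zss: "\<forall>zs \<in> set ?zss. five_cycle h zs"
    using assms(2) by simp
  have "\<forall>(a, b, k) \<in> set ?bs. k = 0 \<or> k \<in> conn h"
    using assms(2) by (simp add: conn_iff)
  from card_period_set_le[OF assms(1) cs ts zss this]
  show ?thesis
    using assms(2) by (simp add: max_def split: if_splits)
qed

text \<open>For \<open>q = 4\<close> the second double wraps around: its other point
  \<open>d + 5*(2*h+1)\<close> is \<open>d\<close> modulo the period.\<close>

lemma card_period_set_le_3_4:
  assumes "periodic_indep h P" "h \<ge> 7" "P 0" "P (2*h+1)" "P (8*h+7)" "P 3"
  shows "int (card (period_set h P)) \<le> 2*h+2"
proof -
  let ?cs = "[0, 2*h+1, 8*h+7, 3]"
  let ?zss = "[] :: int list list"
  let ?bs =
    "[(0, 0, 0), (2*h+1, 2*h+1, 0), (8*h+7, 8*h+7, 0), (3, 3, 0), (6*h+10, 7*h+2, 2*h),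
    (h+6, 2*h-2, 2*h), (4, 4, 3*h), (h+3, h+3, 3*h), (h+5, h+5, 8*h), (4*h-1, 4*h-1, 2*h+5),
    (4*h+4, 4*h+4, 2*h+5), (5*h+4, 5*h+4, 2*h), (6*h+5, 6*h+5, 3*h-2), (5, 5, 0),
    (5*h+2, 5*h+2, 0), (5*h+6, 5*h+6, 0), (10*h+3, 10*h+3, 0), (10*h+4, 10*h+4, 0)]"
  let ?ts =
    "[Low 0, Left 1 0, Low 3, Low 6, Low 13, Left 2 6, Low 7, Left 2 5, Low 8, Low 5, Right 0 0,
    Low 1, Right 3 0, Right 0 1, Right 3 1, High 6, Right 3 2, High 5, Low 9, Right 1 0,
    Right 0 3, High 7, Low 10, Right 1 1, Low 14, Right 1 2, Low 11, Left 2 2, Low 15, Left 2 1,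
    High 9, Low 12, Right 3 4, Left 2 0, High 10, Low 4, Right 0 5, High 11, Right 0 6, Right 3 6,
    Right 0 7, Low 2, Right 3 7, High 4, High 12, Right 1 5, High 8, Right 1 6, Low 16, Low 17]"
  have cs: "\<forall>c\<in>set ?cs. P c"
    using assms by simp
  have ts: "tiling h (map (\<lambda>z. (z, z, 0)) (concat ?zss) @ ?bs) ?cs 0 ?ts"
    using assms(2) by (simp add: conn_ranges_def)
  have zss: "\<forall>zs \<in> set ?zss. five_cycle h zs"
    using assms(2) by simp
  have "\<forall>(a, b, k) \<in> set ?bs. k = 0 \<or> k \<in> conn h"
    using assms(2) by (simp add: conn_iff)
  from card_period_set_le[OF assms(1) cs ts zss this]
  show ?thesis
    using assms(2) by (simp add: max_def split: if_splits)
qed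

lemma card_period_set_le_4_3:
  assumes "periodic_indep h P" "h \<ge> 7" "P 0" "P (2*h+1)" "P (6*h+7)" "P (8*h+8)"
  shows "int (card (period_set h P)) \<le> 2*h+2"
proof -
  let ?cs = "[0, 2*h+1, 6*h+7, 8*h+8]"
  let ?zss = "[] :: int list list"
  let ?bs =
    "[(0, 0, 0), (2*h+1, 2*h+1, 0), (6*h+7, 6*h+7, 0), (8*h+8, 8*h+8, 0), (6*h+10, 7*h+2, 0),
    (h+6, 2*h-2, 0), (5, 5, 3*h-2), (6, 6, 3*h-2), (h+4, h+4, 3*h), (2*h+2, 2*h+2, 8*h+1),
    (2*h+3, 2*h+3, 3*h+2), (3*h+1, 3*h+1, 2*h+6), (3*h+6, 3*h+6, 3*h-1), (5*h+2, 5*h+2, 3*h),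
    (5*h+4, 5*h+4, 3*h-1), (6*h+6, 6*h+6, 2*h+4), (7*h+4, 7*h+4, 3*h), (8*h+9, 8*h+9, 0)]"
  let ?ts =
    "[Low 0, Left 1 0, Left 3 7, Left 2 4, Low 6, Low 7, Left 3 6, Low 8, Left 3 5, Low 5,
    Right 0 0, Low 1, Low 9, Low 10, Right 0 1, Low 11, Right 0 2, High 6, High 7, Left 2 2,
    Low 12, Left 2 1, High 8, Right 1 1, Low 13, Right 1 2, Low 14, High 10, Left 3 2, High 11,
    Left 3 1, High 12, Low 15, Low 2, Left 3 0, Low 4, Right 0 5, Low 16, Right 0 6, High 13,
    High 14, Right 1 4, Right 0 7, Right 2 0, Low 3, Low 17, High 15, Right 2 1, Right 1 6,
    High 9, High 16]"
  have cs: "\<forall>c\<in>set ?cs. P c"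
    using assms by simp
  have ts: "tiling h (map (\<lambda>z. (z, z, 0)) (concat ?zss) @ ?bs) ?cs 0 ?ts"
    using assms(2) by (simp add: conn_ranges_def)
  have zss: "\<forall>zs \<in> set ?zss. five_cycle h zs"
    using assms(2) by simp
  have "\<forall>(a, b, k) \<in> set ?bs. k = 0 \<or> k \<in> conn h"
    using assms(2) by (simp add: conn_iff)
  from card_period_set_le[OF assms(1) cs ts zss this]
  show ?thesis
    using assms(2) by (simp add: max_def split: if_splits)
qed

lemma card_period_set_le_4_4:
  assumes "periodic_indep h P" "h \<ge> 8" "P 0" "P (2*h+1)" "P (8*h+8)" "P 4"
  shows "int (card (period_set h P)) \<le> 2*h+2"
proof -
  let ?cs = "[0, 2*h+1, 8*h+8, 4]"
  let ?zss = "[] :: int list list"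
  \<comment> \<open>At h = 7 both ladders would be empty, and the other 17 blocks alone exceed the
    bound 16.\<close>
  let ?bs =
    "[(0, 0, 0), (2*h+1, 2*h+1, 0), (8*h+8, 8*h+8, 0), (4, 4, 0), (6*h+11, 7*h+2, 2*h),
    (h+7, 2*h-2, 2*h), (5, 5, 3*h), (6, 6, 8*h+1), (h+4, h+4, 8*h+1), (h+6, h+6, 3*h-2),
    (2*h+2, 2*h+2, 3*h), (4*h-1, 4*h-1, 2*h+6), (4*h+3, 4*h+3, 2*h+7), (5*h+4, 5*h+4, 2*h),
    (6*h+6, 6*h+6, 3*h-3), (5*h+5, 5*h+5, 0), (5*h+7, 5*h+7, 0), (10*h+3, 10*h+3, 0),
    (10*h+4, 10*h+4, 0)]"
  let ?ts =
    "[Low 0, Left 1 0, Left 2 7, Low 3, Low 6, Low 7, Left 2 6, Low 8, Left 2 5, Low 9, Low 5,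
    Right 0 0, Low 1, Low 10, Right 3 0, Right 0 1, Right 3 1, High 6, Right 3 2, High 5, Low 11,
    Right 1 0, Right 0 3, Low 12, High 9, Right 1 1, High 10, Right 1 2, Low 13, Low 15, Left 2 2,
    Low 16, Left 2 1, High 11, Low 14, Right 3 4, Left 2 0, High 12, Low 4, Right 0 5, High 13,
    Right 0 6, Right 3 6, Right 0 7, High 7, Low 2, Right 3 7, High 4, High 14, Right 1 5, High 8,
    Right 1 6, Low 17, Low 18]"
  have cs: "\<forall>c\<in>set ?cs. P c"
    using assms by simp
  have ts: "tiling h (map (\<lambda>z. (z, z, 0)) (concat ?zss) @ ?bs) ?cs 0 ?ts"
    using assms(2) by (simp add: conn_ranges_def)
  have zss: "\<forall>zs \<in> set ?zss. five_cycle h zs"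
    using assms(2) by simp
  have "\<forall>(a, b, k) \<in> set ?bs. k = 0 \<or> k \<in> conn h"
    using assms(2) by (simp add: conn_iff)
  from card_period_set_le[OF assms(1) cs ts zss this]
  show ?thesis
    using assms(2) by (simp add: max_def split: if_splits)
qed

lemma card_period_set_le_4_4_7:
  assumes "periodic_indep 7 P" "P 0" "P 15" "P 64" "P 4"
  shows "int (card (period_set 7 P)) \<le> 16"
proof -
  let ?cs = "[0, 15, 64, 4]"
  let ?zss = "[] :: int list list"
  let ?bs =
    "[(0, 0, 0), (15, 15, 0), (64, 64, 0), (4, 4, 0), (5, 5, 21), (6, 6, 62), (11, 11, 20),
    (16, 16, 21), (32, 32, 21), (40, 40, 23), (39, 39, 0), (42, 42, 0), (47, 47, 0), (48, 48, 0),
    (73, 73, 0), (74, 74, 0)]"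
  let ?ts =
    "[Low 0, Left 1 0, Left 2 7, Low 3, Low 4, Low 5, Left 2 6, Low 6, Left 2 5, Right 0 0, Low 1,
    Low 7, Right 3 0, Right 0 1, Right 3 1, High 4, Right 3 2, Right 1 0, Right 0 3, High 6,
    Low 8, Right 1 1, High 7, Right 1 2, Low 10, Low 9, Left 2 2, Low 11, Left 2 1, Low 12,
    Low 13, Right 3 4, Left 2 0, Right 0 5, High 8, Right 0 6, Right 3 6, Right 0 7, High 9,
    Low 2, Right 3 7, Right 1 5, High 5, Right 1 6, Low 14, Low 15]"
  have cs: "\<forall>c\<in>set ?cs. P c"
    using assms by simp
  have ts: "tiling 7 (map (\<lambda>z. (z, z, 0)) (concat ?zss) @ ?bs) ?cs 0 ?ts"
    by (simp add: conn_ranges_def)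
  have zss: "\<forall>zs \<in> set ?zss. five_cycle 7 zs"
    by simp
  have "\<forall>(a, b, k) \<in> set ?bs. k = 0 \<or> k \<in> conn 7"
    by (simp add: conn_iff)
  from card_period_set_le[OF assms(1) cs ts zss this]
  show ?thesis
    by (simp add: max_def split: if_splits)
qed

lemma card_period_set_le_5_3:
  assumes "periodic_indep h P" "h \<ge> 7" "P 0" "P (2*h+1)" "P (6*h+8)" "P (8*h+9)"
  shows "int (card (period_set h P)) \<le> 2*h+2"
proof -
  let ?cs = "[0, 2*h+1, 6*h+8, 8*h+9]"
  let ?zss = "[] :: int list list"
  let ?bs =
    "[(0, 0, 0), (2*h+1, 2*h+1, 0), (6*h+8, 6*h+8, 0), (8*h+9, 8*h+9, 0), (6*h+11, 7*h+2, 0),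
    (h+7, 2*h-2, 0), (6, 6, 3*h-3), (7, 7, 3*h-3), (h+5, h+5, 2*h), (2*h+2, 2*h+2, 8*h+1),
    (2*h+3, 2*h+3, 3*h+2), (3*h+1, 3*h+1, 2*h+5), (3*h+7, 3*h+7, 3*h-1), (5*h+2, 5*h+2, 3*h),
    (5*h+4, 5*h+4, 3*h-1), (5*h+8, 5*h+8, 3*h+2), (6*h+7, 6*h+7, 2*h+4), (7*h+4, 7*h+4, 3*h)]"
  let ?ts =
    "[Low 0, Left 1 0, Left 3 7, Left 2 4, Low 6, Low 7, Left 3 6, Low 8, Left 3 5, Low 5,
    Right 0 0, Low 1, Low 9, Low 10, Right 0 1, Low 11, Right 0 2, High 6, High 7, High 8,
    Left 2 2, Low 12, Left 2 1, Right 1 1, Low 13, Right 1 2, Low 14, High 10, High 11, Left 3 2,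
    Low 15, Left 3 1, High 12, Low 16, Low 2, Left 3 0, Low 4, Right 0 5, Low 17, Right 0 6,
    High 13, High 14, Right 1 4, Right 0 7, Right 2 0, Low 3, High 15, High 16, Right 2 1,
    Right 1 6, High 9, High 17]"
  have cs: "\<forall>c\<in>set ?cs. P c"
    using assms by simp
  have ts: "tiling h (map (\<lambda>z. (z, z, 0)) (concat ?zss) @ ?bs) ?cs 0 ?ts"
    using assms(2) by (simp add: conn_ranges_def)
  have zss: "\<forall>zs \<in> set ?zss. five_cycle h zs"
    using assms(2) by simp
  have "\<forall>(a, b, k) \<in> set ?bs. k = 0 \<or> k \<in> conn h"
    using assms(2) by (simp add: conn_iff)
  from card_period_set_le[OF assms(1) cs ts zss this]
  show ?thesis
    using assms(2) by (simp add: max_def split: if_splits)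
qed

lemma card_period_set_le_5_4:
  assumes "periodic_indep h P" "h \<ge> 8" "P 0" "P (2*h+1)" "P (8*h+9)" "P 5"
  shows "int (card (period_set h P)) \<le> 2*h+2"
proof -
  let ?cs = "[0, 2*h+1, 8*h+9, 5]"
  let ?zss = "[] :: int list list"
  \<comment> \<open>Both ladders are still empty at h = 8, where the other 18 blocks meet 2h + 2 =
    18 exactly; at h = 7 they exceed 16.\<close>
  let ?bs =
    "[(0, 0, 0), (2*h+1, 2*h+1, 0), (8*h+9, 8*h+9, 0), (5, 5, 0), (6*h+12, 7*h+2, 2*h),
    (h+8, 2*h-2, 2*h), (6, 6, 3*h), (7, 7, 8*h), (h+5, h+5, 8*h), (h+7, h+7, 3*h-3),
    (2*h+2, 2*h+2, 3*h), (2*h+3, 2*h+3, 3*h+2), (4*h-1, 4*h-1, 2*h+7), (4*h+3, 4*h+3, 2*h+8),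
    (5*h+4, 5*h+4, 2*h), (5*h+6, 5*h+6, 3*h+2), (6*h+7, 6*h+7, 3*h-4), (5*h+8, 5*h+8, 0),
    (10*h+3, 10*h+3, 0), (10*h+4, 10*h+4, 0)]"
  let ?ts =
    "[Low 0, Left 1 0, Left 2 7, Low 3, Low 6, Low 7, Left 2 6, Low 8, Left 2 5, Low 9, Low 5,
    Right 0 0, Low 1, Low 10, Low 11, Right 0 1, Right 3 1, High 6, Right 3 2, High 5, Low 12,
    Right 1 0, Right 0 3, Low 13, High 9, Right 1 1, High 10, Right 1 2, Low 14, High 11, Low 15,
    Left 2 2, Low 17, Left 2 1, High 12, Low 16, Right 3 4, Left 2 0, High 13, Low 4, Right 0 5,
    High 14, Right 0 6, Right 3 6, High 7, High 15, Low 2, Right 3 7, High 4, High 16, Right 1 5,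
    High 8, Right 1 6, Low 18, Low 19]"
  have cs: "\<forall>c\<in>set ?cs. P c"
    using assms by simp
  have ts: "tiling h (map (\<lambda>z. (z, z, 0)) (concat ?zss) @ ?bs) ?cs 0 ?ts"
    using assms(2) by (simp add: conn_ranges_def)
  have zss: "\<forall>zs \<in> set ?zss. five_cycle h zs"
    using assms(2) by simp
  have "\<forall>(a, b, k) \<in> set ?bs. k = 0 \<or> k \<in> conn h"
    using assms(2) by (simp add: conn_iff)
  from card_period_set_le[OF assms(1) cs ts zss this]
  show ?thesis
    using assms(2) by (simp add: max_def split: if_splits)
qed

lemma card_period_set_le_5_4_7:
  assumes "periodic_indep 7 P" "P 0" "P 15" "P 65" "P 5"
  shows "int (card (period_set 7 P)) \<le> 16"
proof -
  let ?cs = "[0, 15, 65, 5]"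
  let ?zss = "[] :: int list list"
  let ?bs =
    "[(0, 0, 0), (15, 15, 0), (65, 65, 0), (5, 5, 0), (6, 6, 21), (7, 7, 30), (12, 12, 52),
    (16, 16, 57), (17, 17, 23), (22, 22, 19), (31, 31, 18), (32, 32, 21), (39, 39, 19),
    (43, 43, 20), (48, 48, 20), (74, 74, 0)]"
  let ?ts =
    "[Low 0, Left 1 0, Left 2 7, Low 3, Low 4, Low 5, Left 2 6, Low 6, Right 0 0, Low 1, Low 7,
    Low 8, Right 0 1, Low 9, Right 3 1, High 4, Right 1 0, Right 0 3, Low 10, Low 11, Right 1 1,
    High 5, Right 1 2, Low 12, High 8, High 9, Left 2 2, Low 13, Left 2 1, Low 14, High 10,
    Right 3 4, Left 2 0, High 11, Right 0 6, High 12, Right 3 6, High 13, High 6, Low 2,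
    Right 3 7, High 14, Right 1 6, High 7, Low 15]"
  have cs: "\<forall>c\<in>set ?cs. P c"
    using assms by simp
  have ts: "tiling 7 (map (\<lambda>z. (z, z, 0)) (concat ?zss) @ ?bs) ?cs 0 ?ts"
    by (simp add: conn_ranges_def)
  have zss: "\<forall>zs \<in> set ?zss. five_cycle 7 zs"
    by simp
  have "\<forall>(a, b, k) \<in> set ?bs. k = 0 \<or> k \<in> conn 7"
    by (simp add: conn_iff)
  from card_period_set_le[OF assms(1) cs ts zss this]
  show ?thesis
    by (simp add: max_def split: if_splits)
qed

lemma card_period_set_le_h_0:
  assumes "periodic_indep h P" "h \<ge> 7" "P 0" "P (2*h+1)" "P h" "P (3*h+1)"
  shows "int (card (period_set h P)) \<le> 2*h+2"
proof -
  let ?cs = "[0, 2*h+1, h, 3*h+1]"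
  let ?zss = "[] :: int list list"
  let ?bs =
    "[(0, 0, 0), (2*h+1, 2*h+1, 0), (h, h, 0), (3*h+1, 3*h+1, 0), (6*h+6, 7*h-1, 0),
    (h+4, 2*h-4, 0), (h-2, h-2, 6*h+3), (h-1, h-1, 6*h+3), (h+3, h+3, 2*h), (2*h-3, 2*h-3, 2*h+7),
    (2*h-2, 2*h-2, 7*h+5), (2*h+2, 2*h+2, 3*h+2), (2*h+3, 2*h+3, 4*h+2), (4*h+3, 4*h+3, 3*h-3),
    (6*h+2, 6*h+2, 2*h), (6*h+4, 6*h+4, 3*h-2), (7*h+4, 7*h+4, 3*h-1)]"
  let ?ts =
    "[Low 0, Left 3 1, Low 6, Low 7, Low 2, Left 3 0, Low 8, Low 5, Low 9, Low 10, Right 0 0,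
    Low 1, Low 11, Low 12, Right 0 1, Low 3, Right 0 2, High 8, Right 2 1, Right 1 0, Right 0 3,
    Low 13, High 9, Right 1 1, Right 2 3, Right 1 2, High 11, Right 3 1, Low 14, Right 0 4,
    Low 15, High 12, Low 4, High 13, High 6, High 7, Right 0 5, Low 16, Right 0 6, High 14,
    Right 2 5, Right 1 4, Right 2 6, High 15, High 10, Right 1 5, Right 2 7, Right 1 6, High 16,
    Right 3 5]"
  have cs: "\<forall>c\<in>set ?cs. P c"
    using assms by simp
  have ts: "tiling h (map (\<lambda>z. (z, z, 0)) (concat ?zss) @ ?bs) ?cs 0 ?ts"
    using assms(2) by (simp add: conn_ranges_def)
  have zss: "\<forall>zs \<in> set ?zss. five_cycle h zs"
    using assms(2) by simp
  have "\<forall>(a, b, k) \<in> set ?bs. k = 0 \<or> k \<in> conn h"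
    using assms(2) by (simp add: conn_iff)
  from card_period_set_le[OF assms(1) cs ts zss this]
  show ?thesis
    using assms(2) by (simp add: max_def split: if_splits)
qed

lemma card_period_set_le_h_1:
  assumes "periodic_indep h P" "h \<ge> 7" "P 0" "P (2*h+1)" "P (3*h+1)" "P (5*h+2)"
  shows "int (card (period_set h P)) \<le> 2*h+2"
proof -
  let ?cs = "[0, 2*h+1, 3*h+1, 5*h+2]"
  let ?zss = "[] :: int list list"
  let ?bs =
    "[(0, 0, 0), (2*h+1, 2*h+1, 0), (3*h+1, 3*h+1, 0), (5*h+2, 5*h+2, 0), (6*h+7, 7*h, 2*h),
    (h+4, 2*h-2, 2*h), (h-2, h-2, 8*h+5), (h-1, h-1, 3*h), (h+3, h+3, 3*h), (4*h+4, 4*h+4, 2*h),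
    (5*h+4, 5*h+4, 2*h), (6*h+2, 6*h+2, 3*h-1), (6*h+5, 6*h+5, 3*h-3), (6*h+6, 6*h+6, 3*h-1),
    (8*h+3, 8*h+3, 2*h)]"
  let ?ts =
    "[Low 0, Left 2 1, Low 6, Low 7, Left 3 3, Left 2 0, Low 8, Low 5, Right 0 0, Low 1, Left 3 1,
    Right 0 1, Low 2, Left 3 0, High 5, High 7, Right 1 0, Right 0 3, High 8, Low 9, Right 1 1,
    Low 3, Right 1 2, Low 10, Right 2 1, Low 11, Right 0 4, High 9, Low 12, Low 13, Low 4,
    Right 3 0, Right 0 5, High 10, Right 0 6, Right 3 1, Low 14, Right 1 4, Right 0 7, High 4,
    High 11, High 12, High 6, Right 1 5, High 13, Right 1 6, High 14, Right 2 5]"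
  have cs: "\<forall>c\<in>set ?cs. P c"
    using assms by simp
  have ts: "tiling h (map (\<lambda>z. (z, z, 0)) (concat ?zss) @ ?bs) ?cs 0 ?ts"
    using assms(2) by (simp add: conn_ranges_def)
  have zss: "\<forall>zs \<in> set ?zss. five_cycle h zs"
    using assms(2) by simp
  have "\<forall>(a, b, k) \<in> set ?bs. k = 0 \<or> k \<in> conn h"
    using assms(2) by (simp add: conn_iff)
  from card_period_set_le[OF assms(1) cs ts zss this]
  show ?thesis
    using assms(2) by (simp add: max_def split: if_splits)
qed

section \<open>The independence bound\<close>

text \<open>A shortest window with sum at least 2 works: its proper initial and final parts sum to
  at most 1, so both end values are 1 and no value is negative. It is applied to the number of
  points in a fibre minus one.\<close>

lemma window_pair:
  fixes g :: "int \<Rightarrow> int"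
  assumes "\<And>x. g x \<le> 1" "(\<Sum>x\<in>{a..b}. g x) \<ge> 2"
  shows "\<exists>i j. a \<le> i \<and> i < j \<and> j \<le> b \<and> g i = 1 \<and> g j = 1 \<and> (\<forall>k. i < k \<and> k < j \<longrightarrow> g k \<ge> 0)"
  using assms(2)
proof (induction "nat (b - a)" arbitrary: a b rule: less_induct)
  case less
  have ab: "a < b"
  proof (rule ccontr)
    assume "\<not> a < b"
    then have "{a..b} \<subseteq> {a}" by auto
    then have "{a..b} = {} \<or> {a..b} = {a}" by auto
    then show False using less.prems assms(1)[of a] by auto
  qed
  show ?case
  proof (cases "\<exists>l\<in>{a..b}. (\<Sum>x\<in>{a..l-1}. g x) \<ge> 2 \<or> (\<Sum>x\<in>{l+1..b}. g x) \<ge> 2")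
    case True
    then obtain l where l: "l \<in> {a..b}" "(\<Sum>x\<in>{a..l-1}. g x) \<ge> 2 \<or> (\<Sum>x\<in>{l+1..b}. g x) \<ge> 2" by blast
    then consider "(\<Sum>x\<in>{a..l-1}. g x) \<ge> 2" | "(\<Sum>x\<in>{l+1..b}. g x) \<ge> 2" by blast
    then show ?thesis
    proof cases
      case 1
      then obtain i j where "a \<le> i \<and> i < j \<and> j \<le> l-1 \<and> g i = 1 \<and> g j = 1 \<and> (\<forall>k. i < k \<and> k < j \<longrightarrow> g k \<ge> 0)"
        using less.hyps[of "l-1" a] l(1) ab by auto
      then show ?thesis using l(1) by (intro exI[of _ i] exI[of _ j]) auto
    next
      case 2
      then obtain i j where "l+1 \<le> i \<and> i < j \<and> j \<le> b \<and> g i = 1 \<and> g j = 1 \<and> (\<forall>k. i < k \<and> k < j \<longrightarrow> g k \<ge> 0)"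
        using less.hyps[of b "l+1"] l(1) ab by auto
      then show ?thesis using l(1) by (intro exI[of _ i] exI[of _ j]) auto
    qed
  next
    case False
    have split: "(\<Sum>x\<in>{a..b}. g x) = (\<Sum>x\<in>{a..l-1}. g x) + g l + (\<Sum>x\<in>{l+1..b}. g x)" if "l \<in> {a..b}" for l
    proof -
      have "{a..b} = {a..l-1} \<union> {l} \<union> {l+1..b}" using that by auto
      then show ?thesis by (simp add: sum.union_disjoint)
    qed
    have small: "(\<Sum>x\<in>{a..l-1}. g x) \<le> 1" "(\<Sum>x\<in>{l+1..b}. g x) \<le> 1" if "l \<in> {a..b}" for l
      using False that by force+
    have "g a = 1" "g b = 1"
      using split[of a] small[of a] split[of b] small[of b] less.prems ab assms(1)[of a] assms(1)[of b] by auto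
    moreover have "g l \<ge> 0" if "l \<in> {a..b}" for l
      using split[OF that] small[OF that] less.prems by linarith
    ultimately show ?thesis
      using ab by (intro exI[of _ a] exI[of _ b]) auto
  qed
qed

section \<open>Sums over periods, windows and fibres\<close>

lemma periodic_mod:
  fixes g :: "int \<Rightarrow> 'a"
  assumes "\<And>x. g (x + u) = g x"
  shows "g (x mod u) = g x"
proof -
  have "g (y + k * u) = g y" for y k
  proof (induction k rule: int_induct[where k = 0])
    case (step1 i)
    then show ?case using assms[of "y + i * u"] by (simp add: algebra_simps)
  next
    case (step2 i)
    then show ?case using assms[of "y + (i - 1) * u"] by (simp add: algebra_simps)
  qed simp
  from this[of "x mod u" "x div u"] show ?thesis by simp
qed

lemma sum_periodic_shift:
  fixes g :: "int \<Rightarrow> 'a::comm_monoid_add"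
  assumes "u > 0" "\<And>x. g (x + u) = g x"
  shows "(\<Sum>r\<in>{0..<u}. g (r + i)) = (\<Sum>r\<in>{0..<u}. g r)"
  by (rule sum.reindex_bij_witness[of _ "\<lambda>r. (r - i) mod u" "\<lambda>r. (r + i) mod u"])
    (use assms in \<open>auto simp: mod_simps periodic_mod\<close>)

text \<open>Averaging: every residue lies in \<open>m\<close> of the \<open>u\<close> cyclic
  windows, so the window sums total at least 2m > u and one of them exceeds 1.\<close>

lemma periodic_window:
  fixes g :: "int \<Rightarrow> int"
  assumes u: "u > 0" "\<And>x. g (x + u) = g x" and g: "(\<Sum>r\<in>{0..<u}. g r) \<ge> 2" and m: "2 * m > u"
  shows "\<exists>r. (\<Sum>x\<in>{r..r+m-1}. g x) \<ge> 2"
proof (rule ccontr)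
  assume "\<not> ?thesis"
  then have small: "(\<Sum>x\<in>{r..r+m-1}. g x) \<le> 1" for r
    by (metis not_less int_one_le_iff_zero_less zle_diff1_eq one_add_one add_diff_cancel)
  have "m * 2 \<le> (\<Sum>i\<in>{0..m-1}. \<Sum>r\<in>{0..<u}. g (r + i))"
    using g u(1) m sum_periodic_shift[where g = g, OF u(1)] u(2) by simp
  also have "\<dots> = (\<Sum>r\<in>{0..<u}. \<Sum>i\<in>{0..m-1}. g (r + i))"
    by (rule sum.swap)
  also have "\<dots> = (\<Sum>r\<in>{0..<u}. \<Sum>x\<in>{r..r+m-1}. g x)"
    by (intro sum.cong refl sum.reindex_bij_witness[of _ "\<lambda>x. x - r" "\<lambda>i. r + i" for r]) auto
  also have "\<dots> \<le> (\<Sum>r\<in>{0..<u}. 1)"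
    by (intro sum_mono small)
  also have "\<dots> = u" using u by simp
  finally show False using m by simp
qed

lemma sum_fibers:
  fixes F :: "int \<Rightarrow> 'a::comm_monoid_add"
  assumes "u > 0"
  shows "(\<Sum>r\<in>{0..<u}. \<Sum>q\<in>{0..<m}. F (r + q * u)) = (\<Sum>x\<in>{0..<m * u}. F x)"
proof -
  have "(\<Sum>r\<in>{0..<u}. \<Sum>q\<in>{0..<m}. F (r + q * u)) = (\<Sum>(r, q)\<in>{0..<u} \<times> {0..<m}. F (r + q * u))"
    by (rule sum.cartesian_product)
  also have "\<dots> = (\<Sum>x\<in>{0..<m * u}. F x)"
  proof (rule sum.reindex_bij_witness[of _ "\<lambda>x. (x mod u, x div u)" "\<lambda>(r, q). r + q * u"])
    fix p assume p: "p \<in> {0..<u} \<times> {0..<m}"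
    then obtain r q where rq: "p = (r, q)" "0 \<le> r" "r < u" "0 \<le> q" "q < m" by auto
    then have "r + q * u < (q + 1) * u" by (simp add: algebra_simps)
    also have "\<dots> \<le> m * u" using rq assms by (intro mult_right_mono) auto
    finally show "(case p of (r, q) \<Rightarrow> r + q * u) \<in> {0..<m * u}" using rq assms by simp
  next
    fix x assume "x \<in> {0..<m * u}"
    then have x: "0 \<le> x" "x < m * u" by auto
    have "x div u < m"
    proof (rule ccontr)
      assume "\<not> x div u < m"
      then have "m * u \<le> x div u * u" using assms by (intro mult_right_mono) auto
      also have "\<dots> \<le> x" using assms div_mult_mod_eq[of x u] pos_mod_sign[of u x] by linarith
      finally show False using x by simp
    qed
    then show "(x mod u, x div u) \<in> {0..<u} \<times> {0..<m}"
      using assms x by (simp add: pos_imp_zdiv_nonneg_iff)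
  qed (use assms in auto)
  finally show ?thesis .
qed

lemma card_period_set: "int (card (period_set h P)) = (\<Sum>x\<in>{0..<10*h+5}. of_bool (P x))"
proof -
  have "period_set h P = {0..<10*h+5} \<inter> {x. P x}" by (auto simp: period_set_def)
  then show ?thesis by simp
qed

lemma periodic_indep_translate:
  assumes "periodic_indep h P"
  shows "periodic_indep h (\<lambda>x. P (x + c))"
proof -
  have "P (x + (10*h+5) + c) = P (x + c)" for x
    using periodic_indep_shift[OF assms, of "x + c"] by (simp only: ac_simps)
  moreover have "x - y \<notin> conn h" if "P (x + c)" "P (y + c)" for x y
    using periodic_indepD[OF assms that] by simp
  ultimately show ?thesis by (simp add: periodic_indep_def)
qed

lemma card_period_set_translate:
  assumes "periodic_indep h P" "h \<ge> 0"
  shows "card (period_set h (\<lambda>x. P (x + c))) = card (period_set h P)"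
proof -
  have "int (card (period_set h (\<lambda>x. P (x + c)))) = int (card (period_set h P))"
    unfolding card_period_set using assms
    by (intro sum_periodic_shift[where g = "\<lambda>x. of_bool (P x)"]) auto
  then show ?thesis by simp
qed

section \<open>Two doubles with no empty fibre in between\<close>

lemma five_cases:
  "q \<in> {0..<5::int} \<Longrightarrow> q = 0 \<or> q = 1 \<or> q = 2 \<or> q = 3 \<or> q = 4"
  by auto

text \<open>A fibre in between has five candidate points. Points already known exclude four of them
  and force the fifth; after a few fibres near both ends, one is left without any candidate.\<close>

lemma two_doubles_far:
  assumes P: "periodic_indep h P" and d: "6 \<le> d" "d < h"
    and P0: "P 0" "P (2*h+1)"
    and Pd: "P (d+6*h+3) \<and> P (d+8*h+4) \<or> P (d+8*h+4) \<and> P d"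
    and fill: "\<And>k. 0 < k \<Longrightarrow> k < d \<Longrightarrow> P k \<or> P (k+2*h+1) \<or> P (k+4*h+2) \<or> P (k+6*h+3) \<or> P (k+8*h+4)"
  shows False
proof -
  have no: "x - y \<in> conn h \<longrightarrow> \<not> P x \<or> \<not> P y" for x y
    using periodic_indepD[OF P] by blast
  show False
    using Pd
  proof
    assume *: "P (d+6*h+3) \<and> P (d+8*h+4)"
    \<comment> \<open>Each instance of \<open>no\<close> removes one candidate of fibre 1, by its
      adjacency to a point of the two doubles.\<close>
    have 1: "P (2*h+2)"
      using fill[of 1] d * P0 no[of "2*h+1" 1] no[of "d+6*h+3" "4*h+3"] no[of "d+8*h+4" "6*h+4"] no[of "8*h+5" 0]
      by (simp add: conn_iff add.commute)
    have 2: "P (2*h+3)"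
      using fill[of 2] d * P0 no[of "2*h+1" 2] no[of "d+6*h+3" "4*h+4"] no[of "d+8*h+4" "6*h+5"] no[of "8*h+6" 0]
      by (simp add: conn_iff add.commute)
    have 3: "P (8*h+7)"
      using fill[of 3] d * P0 1 no[of "2*h+2" 3] no[of "2*h+4" 0] no[of "4*h+5" "2*h+1"] no[of "d+8*h+4" "6*h+6"]
      by (simp add: conn_iff add.commute)
    \<comment> \<open>For d = 6 the difference \<open>d+2*h-3\<close> of \<open>d+8*h+4\<close> and
      \<open>6*h+7\<close> is just below \<open>2*h+4\<close>, so \<open>6*h+7\<close> is excluded
      by \<open>8*h+7\<close> instead.\<close>
    have 4: "P (8*h+8)"
      using fill[of 4] d * P0 2 3 no[of "2*h+3" 4] no[of "2*h+5" 0] no[of "4*h+6" "2*h+1"] no[of "d+8*h+4" "6*h+7"]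
        no[of "8*h+7" "6*h+7"]
      by (cases "d = 6") (simp_all add: conn_iff add.commute)
    have 5: "P (d+6*h+1)"
      using fill[of "d-2"] d * P0 no[of "d+8*h+4" "d-2"] no[of "d-2+2*h+1" 0] no[of "d-2+4*h+2" "2*h+1"]
        no[of "d-2+8*h+4" "d+6*h+3"]
      by (simp add: conn_iff algebra_simps)
    \<comment> \<open>The point \<open>d+6*h+1\<close> is adjacent to \<open>8*h+7\<close> for d = 6
      and d = 7, and to \<open>8*h+8\<close> for d = 8.\<close>
    have "d \<ge> 9"
      using 3 4 5 d * no[of "8*h+7" "d+6*h+1"] no[of "8*h+8" "d+6*h+1"] no[of "8*h+8" "d+6*h+3"]
      by (fastforce simp: conn_iff)
    \<comment> \<open>From d = 9 on, \<open>8*h+10-d\<close> lies in the run ending at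
      \<open>8*h+1\<close>, so \<open>8*h+7\<close> excludes \<open>d-3\<close>, the last candidate
      of its fibre.\<close>
    then show False
      using fill[of "d-3"] d * P0 3 5 no[of "8*h+7" "d-3"] no[of "d-3+2*h+1" 0] no[of "d-3+4*h+2" "2*h+1"]
        no[of "d+8*h+4" "d-3+6*h+3"] no[of "d-3+8*h+4" "d+6*h+1"]
      by (simp add: conn_iff algebra_simps)
  next
    assume *: "P (d+8*h+4) \<and> P d"
    have 3: "P 3"
      using fill[of 3] d * P0 no[of "2*h+4" 0] no[of "4*h+5" "2*h+1"] no[of "d+8*h+4" "6*h+6"] no[of "8*h+7" d]
      by (simp add: conn_iff add.commute)
    have 1: "P (4*h+3)"
      using fill[of 1] d * P0 3 no[of "2*h+1" 1] no[of "2*h+2" 3] no[of "d+8*h+4" "6*h+4"] no[of "8*h+5" 0]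
      by (simp add: conn_iff add.commute)
    have 5: "P (d-3)"
      using fill[of "d-3"] d * P0 no[of "d-3+2*h+1" 0] no[of "d-3+4*h+2" "2*h+1"]
        no[of "d+8*h+4" "d-3+6*h+3"] no[of "d-3+8*h+4" d]
      by (simp add: conn_iff algebra_simps)
    \<comment> \<open>The forced points \<open>4*h+3\<close> and \<open>d-3\<close> exclude the two
      candidates of fibre \<open>d-1\<close> that the doubles leave.\<close>
    show False
      using fill[of "d-1"] d * P0 1 5 no[of "d+8*h+4" "d-1"] no[of "d-1+2*h+1" 0] no[of "d-1+4*h+2" "2*h+1"]
        no[of "d-1+6*h+3" "4*h+3"] no[of "d-1+8*h+4" "d-3"]
      by (simp add: conn_iff algebra_simps)
  qed
qed

text \<open>Single adjacencies between the doubles leave only \<open>q\<close> = 1, 2 for d \<le> 2,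
  \<open>q\<close> = 3, 4 for 3 \<le> d < h, and \<open>q\<close> = 0, 1 for d = h. The range 6
  \<le> d < h is contradictory; every other pair has its cover.\<close>

lemma two_doubles_near:
  assumes P: "periodic_indep h P" and h: "h \<ge> 7" and d: "1 \<le> d" "d \<le> h" and q: "q \<in> {0..<5}"
    and P0: "P 0" "P (2*h+1)" and Pd: "P (d + q * (2*h+1))" "P (d + (q + 1) * (2*h+1))"
    and fill: "\<And>k. 0 < k \<Longrightarrow> k < d \<Longrightarrow> \<exists>q\<in>{0..<5}. P (k + q * (2*h+1))"
  shows "int (card (period_set h P)) \<le> 2*h+2"
proof -
  have no: "x - y \<in> conn h \<longrightarrow> \<not> P x \<or> \<not> P y" for x y
    using periodic_indepD[OF P] by blast
  have fill': "P k \<or> P (k+2*h+1) \<or> P (k+4*h+2) \<or> P (k+6*h+3) \<or> P (k+8*h+4)" if k: "0 < k" "k < d" for k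
  proof -
    obtain r where "r \<in> {0..<5}" "P (k + r * (2*h+1))" using fill[OF k] by blast
    with five_cases[of r] show ?thesis by (auto simp: ring_distribs ac_simps simp del: atLeastLessThan_iff)
  qed
  have wrap: "P d" if "P (d + 5 * (2*h+1))"
    using that periodic_indep_shift[OF P, of d] by (simp add: algebra_simps)
  have "P d \<and> P (d+2*h+1) \<or> P (d+2*h+1) \<and> P (d+4*h+2) \<or> P (d+4*h+2) \<and> P (d+6*h+3)
      \<or> P (d+6*h+3) \<and> P (d+8*h+4) \<or> P (d+8*h+4) \<and> P d"
    using five_cases[OF q] Pd wrap by (elim disjE) (simp_all add: ring_distribs ac_simps)
  then consider (0) "P d" "P (d+2*h+1)" | (1) "P (d+2*h+1)" "P (d+4*h+2)" | (2) "P (d+4*h+2)" "P (d+6*h+3)"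
    | (3) "P (d+6*h+3)" "P (d+8*h+4)" | (4) "P (d+8*h+4)" "P d"
    by blast
  note cases5 = this
  \<comment> \<open>\<open>d+2*h+1\<close> lies in the run from \<open>2*h+4\<close> to
    \<open>3*h\<close> exactly when 3 \<le> d < h.\<close>
  have small: "d \<in> {1, 2}" if "P (d+2*h+1)" "d \<noteq> h"
    using no[of "d+2*h+1" 0] that d P0 by (simp add: conn_iff) linarith
  consider "d = 1" | "d = 2" | "d = 3" | "d = 4" | "d = 5" | "6 \<le> d" "d < h" | "d = h"
    using d by linarith
  then show ?thesis
  proof cases
    assume [simp]: "d = 1"
    show ?thesis using cases5
    proof cases
      case 0 then show ?thesis using no[of "2*h+1" 1] P0 by (simp add: conn_iff)
    next
      case 1 then show ?thesis using card_period_set_le_1_1[OF P h P0] by (simp add: add.commute)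
    next
      case 2 then show ?thesis using card_period_set_le_1_2[OF P h P0] by (simp add: add.commute)
    next
      case 3 then show ?thesis using no[of "8*h+5" 0] P0 by (simp add: conn_iff add.commute)
    next
      case 4 then show ?thesis using no[of "8*h+5" 0] P0 by (simp add: conn_iff add.commute)
    qed
  next
    assume [simp]: "d = 2"
    show ?thesis using cases5
    proof cases
      case 0 then show ?thesis using no[of "2*h+1" 2] P0 by (simp add: conn_iff)
    next
      case 1 then show ?thesis using card_period_set_le_2_1[OF P h P0] by (simp add: add.commute)
    next
      case 2
      then show ?thesis
        using card_period_set_le_2_2[OF P _ P0] card_period_set_le_2_2_7[of P] P P0 h
        by (cases "h = 7") (simp_all add: add.commute)
    next
      case 3 then show ?thesis using no[of "8*h+6" 0] P0 by (simp add: conn_iff add.commute)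
    next
      case 4 then show ?thesis using no[of "8*h+6" 0] P0 by (simp add: conn_iff add.commute)
    qed
  next
    assume dh: "d = h"
    show ?thesis using cases5
    proof cases
      case 0 then show ?thesis using card_period_set_le_h_0[OF P h P0] by (simp add: dh)
    next
      case 1 then show ?thesis using card_period_set_le_h_1[OF P h P0] by (simp add: dh)
    next
      case 2 then show ?thesis using no[of "7*h+3" 0] P0 by (simp add: conn_iff dh)
    next
      case 3 then show ?thesis using no[of "7*h+3" 0] P0 by (simp add: conn_iff dh)
    next
      case 4 then show ?thesis using no[of "9*h+4" "2*h+1"] P0 by (simp add: conn_iff dh)
    qed
  next
    assume d6: "6 \<le> d" "d < h"
    have "P (d+6*h+3) \<and> P (d+8*h+4) \<or> P (d+8*h+4) \<and> P d"
      using cases5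
    proof cases
      case 2 then show ?thesis using no[of "d+4*h+2" "2*h+1"] d6 P0 by (simp add: conn_iff)
    qed (use small d6 in auto)
    then show ?thesis using two_doubles_far[OF P d6 P0 _ fill'] by blast
  next
    assume [simp]: "d = 3"
    show ?thesis using cases5
    proof cases
      case 2 then show ?thesis using no[of "4*h+5" "2*h+1"] h P0 by (simp add: conn_iff add.commute)
    next
      case 3 then show ?thesis using card_period_set_le_3_3[OF P h P0] by (simp add: add.commute)
    next
      case 4 then show ?thesis using card_period_set_le_3_4[OF P h P0] by (simp add: add.commute)
    qed (use small h in auto)
  next
    assume [simp]: "d = 4"
    show ?thesis using cases5
    proof cases
      case 2 then show ?thesis using no[of "4*h+6" "2*h+1"] h P0 by (simp add: conn_iff add.commute)
    next
      case 3 then show ?thesis using card_period_set_le_4_3[OF P h P0] by (simp add: add.commute)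
    next
      case 4
      then show ?thesis
        using card_period_set_le_4_4[OF P _ P0] card_period_set_le_4_4_7[of P] P P0 h
        by (cases "h = 7") (simp_all add: add.commute)
    qed (use small h in auto)
  next
    assume [simp]: "d = 5"
    show ?thesis using cases5
    proof cases
      case 2 then show ?thesis using no[of "4*h+7" "2*h+1"] h P0 by (simp add: conn_iff add.commute)
    next
      case 3 then show ?thesis using card_period_set_le_5_3[OF P h P0] by (simp add: add.commute)
    next
      case 4
      then show ?thesis
        using card_period_set_le_5_4[OF P _ P0] card_period_set_le_5_4_7[of P] P P0 h
        by (cases "h = 7") (simp_all add: add.commute)
    qed (use small h in auto)
  qed
qed

lemma card_independent_le:
  assumes P: "periodic_indep h P" and h: "h \<ge> 7"
  shows "int (card (period_set h P)) \<le> 2*h+2"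
proof (rule ccontr)
  assume big: "\<not> ?thesis"
  define u where "u = 2*h+1"
  define f where "f r = (\<Sum>q\<in>{0..<5}. of_bool (P (r + q * u)) :: int)" for r
  have u: "u > 0" "5 * u = 10*h+5" using h by (auto simp: u_def)
  have range5: "{0..<5::int} = {0, 1, 2, 3, 4}" by auto
  have f_eq: "f r = of_bool (P r) + of_bool (P (r+u)) + of_bool (P (r+2*u)) + of_bool (P (r+3*u)) + of_bool (P (r+4*u))" for r
    by (simp add: f_def range5 add.assoc)
  have shift: "P (r + 5*u) = P r" for r
    using periodic_indep_shift[OF P, of r] u by simp
  have no: "\<not> P x \<or> \<not> P (x + 2*u)" "\<not> P x \<or> \<not> P (x + 3*u)" for x
    using periodic_indepD[OF P, of "x + 2*u" x] periodic_indepD[OF P, of "x + 3*u" x]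
    by (auto simp: conn_iff u_def)
  have no_pair: "\<not> P r \<or> \<not> P (r+2*u)" "\<not> P r \<or> \<not> P (r+3*u)" "\<not> P (r+u) \<or> \<not> P (r+3*u)"
      "\<not> P (r+u) \<or> \<not> P (r+4*u)" "\<not> P (r+2*u) \<or> \<not> P (r+4*u)" for r
    using no[of r] no[of "r+u"] no[of "r+2*u"] by (simp_all add: add.assoc)
  have f_le: "f r \<le> 2" for r
    using no_pair[of r] by (auto simp: f_eq)
  \<comment> \<open>The nonadjacent pairs of the 5-cycle on a fibre are \<open>q\<close>,
    \<open>q+1\<close> modulo 5; \<open>shift\<close> covers the pair that wraps from 4 to
    0.\<close>
  have f_2: "\<exists>q\<in>{0..<5}. P (r + q*u) \<and> P (r + (q+1)*u)" if "f r = 2" for r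
    using that no_pair[of r] shift[of r] unfolding range5 f_eq
    by (cases "P r"; cases "P (r+u)"; cases "P (r+2*u)"; cases "P (r+3*u)"; cases "P (r+4*u)") simp_all
  have f_pos: "\<exists>q\<in>{0..<5}. P (r + q*u)" if "f r \<ge> 1" for r
    using that unfolding range5 f_eq
    by (cases "P r"; cases "P (r+u)"; cases "P (r+2*u)"; cases "P (r+3*u)"; cases "P (r+4*u)") simp_all
  have f_shift: "f (r + u) = f r" for r
    using shift[of r] by (simp add: f_eq algebra_simps)
  have "(\<Sum>r\<in>{0..<u}. f r) = int (card (period_set h P))"
    using sum_fibers[OF u(1), of "\<lambda>x. of_bool (P x) :: int" 5] u(2) by (simp only: f_def card_period_set)
  \<comment> \<open>\<open>f r - 1\<close> is 1 on doubles and -1 on empty fibres. Its total is the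
    order of the set minus \<open>u\<close>, hence at least 2.\<close>
  then have "(\<Sum>r\<in>{0..<u}. f r - 1) \<ge> 2"
    using big u(1) by (simp add: sum_subtractf u_def)
  \<comment> \<open>A window of \<open>h+1\<close> fibres is just over half of all
    \<open>2*h+1\<close>, which keeps the two doubles within distance \<open>h\<close>.\<close>
  then obtain a where a: "(\<Sum>x\<in>{a..a+(h+1)-1}. f x - 1) \<ge> 2"
    using periodic_window[of u "\<lambda>r. f r - 1" "h+1"] u f_shift by (auto simp: u_def)
  obtain i j where ij: "a \<le> i" "i < j" "j \<le> a + h" "f i = 2" "f j = 2" "\<And>k. i < k \<Longrightarrow> k < j \<Longrightarrow> f k \<ge> 1"
    using window_pair[OF _ a] f_le by force
  obtain p where p: "p \<in> {0..<5}" "P (i + p*u)" "P (i + (p+1)*u)" using f_2 ij(4) by blast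
  \<comment> \<open>The translation puts the first double at 0 and \<open>u\<close>; the second then
    starts at \<open>j - i + ((q - p) mod 5) * u\<close>.\<close>
  let ?Q = "\<lambda>x. P (x + (i + p*u))"
  have mod5: "P (r + (q mod 5) * u) = P (r + q*u)" for r q
    using periodic_mod[where g = "\<lambda>q. P (r + q*u)" and u = 5 and x = q] shift[of "r + x*u" for x] by (simp add: algebra_simps)
  have Qi: "?Q (r - i + ((q - p) mod 5) * u) = P (r + q*u)" for r q
    using mod5[of "r + p*u" "q - p"] by (simp add: algebra_simps)
  have Qi': "?Q (r - i + ((q - p) mod 5 + 1) * u) = P (r + (q + 1)*u)" for r q
    using mod5[of "r + p*u + u" "q - p"] by (simp add: algebra_simps)
  obtain q where q: "P (j + q*u)" "P (j + (q+1)*u)" using f_2 ij(5) by blast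
  have "int (card (period_set h ?Q)) \<le> 2*h+2"
  proof (rule two_doubles_near[OF periodic_indep_translate[OF P] h, of "j - i" "(q - p) mod 5"])
    fix k assume k: "0 < k" "k < j - i"
    then obtain r where "P (k + i + r*u)" using f_pos ij(6)[of "k + i"] by auto
    then show "\<exists>r\<in>{0..<5}. ?Q (k + r * (2*h+1))"
      using Qi[of "k + i" r] by (intro bexI[of _ "(r - p) mod 5"]) (simp_all add: u_def)
  qed (use ij p q Qi[of j q] Qi'[of j q] in \<open>simp_all add: u_def algebra_simps\<close>)
  then show False
    using big card_period_set_translate[OF P] h by simp
qed

lemma conn_rangesE:
  assumes "z \<in> conn h"
  obtains p q where "(p, q) \<in> set (conn_ranges h)" "p \<le> z" "z \<le> q"
proof -
  have "\<exists>(p, q)\<in>set (conn_ranges h). p \<le> z \<and> z \<le> q"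
    using assms unfolding conn_iff by (elim disjE) (simp_all add: conn_ranges_def)
  then show ?thesis using that by blast
qed

section \<open>Critical edges\<close>

text \<open>With \<open>a \<le> b + 1\<close>, the order of \<open>{a..b}\<close> is
  \<open>b - a + 1\<close> even when it is empty, so orders stay linear in \<open>h\<close>.\<close>

fun ascending :: "int \<Rightarrow> (int \<times> int) list \<Rightarrow> bool" where
  "ascending l [] \<longleftrightarrow> True"
| "ascending l ((a, b) # xs) \<longleftrightarrow> l \<le> a \<and> a \<le> b + 1 \<and> ascending (b + 1) xs"

abbreviation intervals :: "(int \<times> int) list \<Rightarrow> int set" where
  "intervals xs \<equiv> \<Union>(a, b)\<in>set xs. {a..b}"

lemma ascending_le: "ascending l xs \<Longrightarrow> x \<in> intervals xs \<Longrightarrow> l \<le> x"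
proof (induction xs arbitrary: l)
  case (Cons p xs)
  obtain a b where p: "p = (a, b)" by (cases p)
  show ?case
  proof (cases "x \<in> {a..b}")
    case True
    then show ?thesis using Cons.prems(1) by (simp add: p)
  next
    case False
    moreover have "x \<in> {a..b} \<union> intervals xs"
      using Cons.prems(2) by (simp add: p)
    ultimately have x: "x \<in> intervals xs" by blast
    have "b + 1 \<le> x"
      using Cons.IH[OF _ x, of "b + 1"] Cons.prems(1) by (simp add: p)
    then show ?thesis
      using Cons.prems(1) by (simp add: p)
  qed
qed simp

lemma card_intervals: "ascending l xs \<Longrightarrow> int (card (intervals xs)) = (\<Sum>(a, b)\<leftarrow>xs. b - a + 1)"
proof (induction xs arbitrary: l)
  case (Cons p xs)
  obtain a b where p: "p = (a, b)" by (cases p)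
  have asc: "ascending (b + 1) xs" and ab: "a \<le> b + 1"
    using Cons.prems by (simp_all add: p)
  have "{a..b} \<inter> intervals xs = {}"
  proof (rule equals0I)
    fix x assume "x \<in> {a..b} \<inter> intervals xs"
    then show False using ascending_le[OF asc, of x] by simp
  qed
  then have "card ({a..b} \<union> intervals xs) = card {a..b} + card (intervals xs)"
    by (intro card_Un_disjoint) auto
  moreover have "intervals (p # xs) = {a..b} \<union> intervals xs"
    by (simp add: p)
  ultimately have "int (card (intervals (p # xs))) = (b - a + 1) + int (card (intervals xs))"
    using ab by simp
  then show ?case using Cons.IH[OF asc] by (simp add: p)
qed simp

text \<open>The order 2h + 3 is t. Translates of \<open>J\<close> serve every edge of difference
  \<open>s\<close>.\<close>

definition critical :: "int \<Rightarrow> int \<Rightarrow> bool" where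
  "critical h s \<longleftrightarrow> (\<exists>J\<subseteq>{0..<10*h+5}. int (card J) = 2*h+3 \<and> 0 \<in> J \<and> s \<in> J \<and>
     (\<forall>i\<in>J. \<forall>j\<in>J. i - j \<in> conn h \<longrightarrow> i = s \<and> j = 0))"

text \<open>Differences between \<open>{a..b}\<close> and \<open>{c..d}\<close> fill the interval
  from \<open>a - d\<close> to \<open>b - c\<close>, so comparing endpoints with the runs of the
  connection set shows nonadjacency. Only the pair of singletons \<open>s\<close> and 0 is
  exempt.\<close>

lemma criticalI:
  assumes asc: "ascending 0 xs" and n: "\<forall>(a, b)\<in>set xs. b < 10*h+5"
    and sum: "(\<Sum>(a, b)\<leftarrow>xs. b - a + 1) = 2*h+3" and mem: "0 \<in> intervals xs" "s \<in> intervals xs"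
    and sep: "\<forall>(a, b)\<in>set xs. \<forall>(c, d)\<in>set xs. a = s \<and> b = s \<and> c = 0 \<and> d = 0 \<or>
      (\<forall>(p, q)\<in>set (conn_ranges h). b - c < p \<or> q < a - d)"
  shows "critical h s"
proof -
  have crit: "i = s \<and> j = 0" if ij: "i \<in> intervals xs" "j \<in> intervals xs" "i - j \<in> conn h" for i j
  proof -
    obtain a b c d where ab: "(a, b) \<in> set xs" "a \<le> i" "i \<le> b" and cd: "(c, d) \<in> set xs" "c \<le> j" "j \<le> d"
      using ij(1,2) by auto
    obtain p q where pq: "(p, q) \<in> set (conn_ranges h)" "p \<le> i - j" "i - j \<le> q"
      using ij(3) by (rule conn_rangesE)
    have "a = s \<and> b = s \<and> c = 0 \<and> d = 0 \<or> (\<forall>(p, q)\<in>set (conn_ranges h). b - c < p \<or> q < a - d)"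
      using bspec[OF bspec[OF sep ab(1), unfolded prod.case] cd(1)] by simp
    then show ?thesis
    proof
      assume "\<forall>(p, q)\<in>set (conn_ranges h). b - c < p \<or> q < a - d"
      from bspec[OF this pq(1)] show ?thesis using ab cd pq by simp
    qed (use ab cd in auto)
  qed
  have sub: "intervals xs \<subseteq> {0..<10*h+5}"
  proof
    fix x assume x: "x \<in> intervals xs"
    then obtain a b where ab: "(a, b) \<in> set xs" "x \<le> b" by auto
    show "x \<in> {0..<10*h+5}" using ascending_le[OF asc x] bspec[OF n ab(1)] ab(2) by simp
  qed
  have "int (card (intervals xs)) = 2*h+3"
    using card_intervals[OF asc] sum by (simp only:)
  with crit sub mem show ?thesis
    unfolding critical_def by blast
qed

lemma critical_conn:
  assumes h: "h \<ge> 7" and s: "s \<in> conn h" "s \<le> 4*h+2"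
  shows "critical h s"
proof -
  define j where "j = s - (2*h+1)"
  consider "s = 2*h-1" | "s = 2*h" | "s = 3*h+2" | "s = 4*h+2" | "3 \<le> j" "j \<le> h-3" | "j = h-2" | "j = h-1"
    using s h unfolding conn_iff j_def by linarith
  then show ?thesis
  proof cases
    case 1
    show ?thesis
      by (rule criticalI[where xs = "[(0, 0), (3, 2*h-4), (2*h-1, 2*h-1), (2*h+1, 2*h+1), (6*h-1, 6*h),
          (6*h+2, 6*h+2), (6*h+4, 6*h+5), (10*h+3, 10*h+3)]"])
        (use h 1 in \<open>simp_all add: conn_ranges_def\<close>)
  next
    case 2
    show ?thesis
      by (rule criticalI[where xs = "[(0, 0), (4, h), (h+2, h+2), (2*h, 2*h), (2*h+2, 2*h+2), (4*h+3, 4*h+3),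
          (5*h+3, 5*h+3), (5*h+5, 6*h+1), (6*h+5, 6*h+6), (10*h+4, 10*h+4)]"])
        (use h 2 in \<open>simp_all add: conn_ranges_def\<close>)
  next
    case 3
    show ?thesis
      by (rule criticalI[where xs = "[(0, 0), (h, h), (3*h+1, 3*h+1), (3*h+2, 3*h+2), (4*h+1, 4*h+1),
          (4*h+3, 5*h-1), (5*h+3, 5*h+4), (9*h+2, 9*h+3), (9*h+7, 10*h+3)]"])
        (use h 3 in \<open>simp_all add: conn_ranges_def\<close>)
  next
    case 4
    show ?thesis
      by (rule criticalI[where xs = "[(0, 0), (3, h-1), (h+1, h+1), (2*h+1, 2*h+1), (4*h+2, 4*h+2),
          (5*h+2, 5*h+2), (5*h+4, 6*h), (6*h+4, 6*h+5), (10*h+3, 10*h+4)]"])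
        (use h 4 in \<open>simp_all add: conn_ranges_def\<close>)
  next
    case 5
    \<comment> \<open>\<open>m \<ge> 3\<close> keeps the interval from \<open>m\<close> to
      \<open>j\<close> off the neighbours 1 and 2 of \<open>2*h+1\<close>.
      \<open>m \<ge> j - 2\<close> keeps its differences to \<open>s\<close> within
      \<open>2*h+1\<close> to \<open>2*h+3\<close>, below the run from \<open>2*h+4\<close>.\<close>
    define m where "m = max 3 (j-2)"
    have m: "3 \<le> m" "j - 2 \<le> m" "m \<le> j" using 5 by (auto simp: m_def)
    have s_eq: "s = 2*h+1+j" by (simp add: j_def)
    show ?thesis
      by (rule criticalI[where xs = "[(0, 0), (m, j), (j+3, 2*h-2), (2*h+1, 2*h+1), (2*h+1+j, 2*h+1+j),
          (6*h+1, 6*h+2), (6*h+4, 6*h+2+m), (6*h+4+j, 6*h+5+j)]"])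
        (use h 5 m in \<open>simp_all add: conn_ranges_def s_eq\<close>)
  next
    case 6
    then have s_eq: "s = 3*h-1" by (simp add: j_def)
    show ?thesis
      by (rule criticalI[where xs = "[(0, 0), (3*h-1, 3*h-1), (3*h+3, 4*h+1), (4*h+3, 5*h-3), (5*h, 5*h+1),
          (8*h+4, 8*h+4), (9*h, 9*h+1), (9*h+4, 9*h+5)]"])
        (use h in \<open>simp_all add: conn_ranges_def s_eq\<close>)
  next
    case 7
    then have s_eq: "s = 3*h" by (simp add: j_def)
    show ?thesis
      by (rule criticalI[where xs = "[(0, 0), (3*h, 3*h), (3*h+3, 4*h+1), (4*h+3, 5*h-2), (5*h+1, 5*h+1),
          (8*h+4, 8*h+4), (9*h+1, 9*h+2), (9*h+4, 9*h+5)]"])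
        (use h in \<open>simp_all add: conn_ranges_def s_eq\<close>)
  qed
qed

section \<open>Sum-freeness, degree and common neighbours\<close>

lemma conn_bounds: "z \<in> conn h \<Longrightarrow> h \<ge> 7 \<Longrightarrow> 0 < z \<and> z < 10*h+5"
  by (auto simp: conn_iff)

lemma conn_reflect: "10*h+5 - z \<in> conn h \<longleftrightarrow> z \<in> conn h"
  unfolding conn_iff by linarith

lemma conn_sum_free:
  assumes "h \<ge> 7" "p \<in> conn h" "q \<in> conn h"
  shows "p + q \<notin> conn h"
  using assms(2)[unfolded conn_iff] assms(3)[unfolded conn_iff] assms(1)
  by (elim disjE) (simp_all add: conn_iff)

lemma card_conn: "h \<ge> 7 \<Longrightarrow> int (card (conn h)) = 2*h+2"
proof -
  assume h: "h \<ge> 7"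
  have "conn h = intervals (conn_ranges h)"
    unfolding conn_def conn_ranges_def by auto
  moreover have "ascending 0 (conn_ranges h)" "(\<Sum>(a, b)\<leftarrow>conn_ranges h. b - a + 1) = 2*h+2"
    using h by (simp_all add: conn_ranges_def)
  ultimately show ?thesis
    using card_intervals[of 0 "conn_ranges h"] by (simp only:)
qed

text \<open>By the symmetry of the connection set, \<open>a\<close> is a common neighbour of 0 and
  \<open>d\<close>. The outer cases are the gaps of the connection set below half the
  period.\<close>

lemma common_neighbour:
  assumes h: "h \<ge> 7" and d: "0 < d" "d \<le> 5*h+2" "d \<notin> conn h"
  shows "\<exists>a\<in>conn h. d - a \<in> conn h \<or> a - d \<in> conn h"
proof -
  have witness: ?thesis if "a \<in> conn h" "d - a \<in> conn h \<or> a - d \<in> conn h" for a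
    using that by blast
  consider "d < 2*h-1" | "2*h < d" "d < 2*h+4" | "d = 3*h+1" | "3*h+2 < d" "d < 4*h+2" | "4*h+2 < d"
    using d(3) unfolding conn_iff by linarith
  then show ?thesis
  proof cases
    case 1
    then consider "d = 1" | "d = 2" | "d = 3" | "4 \<le> d" "d \<le> h" | "d = h+1" | "h+2 \<le> d" "d \<le> 2*h-2"
      using d(1) by linarith
    then show ?thesis
    proof cases
      case 1 then show ?thesis by (intro witness[of "2*h"]) (simp_all add: conn_iff)
    next
      case 2 then show ?thesis using h by (intro witness[of "2*h+6"]) (simp_all add: conn_iff)
    next
      \<comment> \<open>\<open>2*h+7\<close> belongs to the run ending at \<open>3*h\<close> exactly
        from h = 7 on.\<close>
      case 3 then show ?thesis using h by (intro witness[of "2*h+7"]) (simp_all add: conn_iff)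
    next
      case 4 then show ?thesis using h by (intro witness[of "2*h+d"]) (simp_all add: conn_iff)
    next
      case 5 then show ?thesis using h by (intro witness[of "3*h"]) (simp_all add: conn_iff)
    next
      case 6 then show ?thesis using h by (intro witness[of "4*h+2"]) (simp_all add: conn_iff)
    qed
  next
    case 2
    then consider "d = 2*h+1" | "d = 2*h+2" | "d = 2*h+3" by linarith
    then show ?thesis
    proof cases
      case 1 then show ?thesis by (intro witness[of "6*h+3"]) (simp_all add: conn_iff)
    next
      case 2 then show ?thesis by (intro witness[of "4*h+2"]) (simp_all add: conn_iff)
    next
      case 3 then show ?thesis by (intro witness[of "4*h+2"]) (simp_all add: conn_iff)
    qed
  next
    case 3 then show ?thesis by (intro witness[of "6*h+3"]) (simp_all add: conn_iff)
  next
    case 4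
    then consider "d \<le> 4*h-1" | "d = 4*h" | "d = 4*h+1" by linarith
    then show ?thesis
    proof cases
      case 1 with 4 show ?thesis by (intro witness[of "6*h+3"]) (simp_all add: conn_iff)
    next
      case 2 then show ?thesis by (intro witness[of "2*h"]) (simp_all add: conn_iff)
    next
      case 3 then show ?thesis by (intro witness[of "7*h+3"]) (simp_all add: conn_iff)
    qed
  next
    case 5
    then consider "d = 4*h+3" | "4*h+4 \<le> d" "d \<le> 5*h" | "d = 5*h+1" | "d = 5*h+2"
      using d(2) by linarith
    then show ?thesis
    proof cases
      case 1 then show ?thesis using h by (intro witness[of "2*h-1"]) (simp_all add: conn_iff)
    next
      case 2 then show ?thesis by (intro witness[of "2*h"]) (simp_all add: conn_iff)
    next
      case 3 then show ?thesis using h by (intro witness[of "2*h+4"]) (simp_all add: conn_iff)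
    next
      case 4 then show ?thesis by (intro witness[of "2*h"]) (simp_all add: conn_iff)
    qed
  qed
qed

section \<open>The graph\<close>

text \<open>This passes between residues, used for edges of the graph, and unreduced differences,
  used for independent sets.\<close>

lemma mod_conn_iff:
  assumes "h \<ge> 7" "- (10*h+5) < z" "z < 10*h+5"
  shows "z mod (10*h+5) \<in> conn h \<longleftrightarrow> z \<in> conn h \<or> - z \<in> conn h"
proof (cases "z \<ge> 0")
  case True
  then show ?thesis using assms conn_bounds[of "- z" h] by auto
next
  case False
  have "z mod (10*h+5) = (z + (10*h+5)) mod (10*h+5)" by simp
  also have "\<dots> = 10*h+5 - (- z)"
    using False assms by (subst mod_pos_pos_trivial) auto
  finally have "z mod (10*h+5) \<in> conn h \<longleftrightarrow> - z \<in> conn h" by (simp only: conn_reflect)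
  moreover have "z \<notin> conn h" using False assms(1) conn_bounds[of z h] by auto
  ultimately show ?thesis by blast
qed

lemma mod_conn_uminus:
  assumes "h \<ge> 7"
  shows "(y - x) mod (10*h+5) \<in> conn h \<longleftrightarrow> (x - y) mod (10*h+5) \<in> conn h"
proof -
  define z where "z = (x - y) mod (10*h+5)"
  have z: "0 \<le> z" "z < 10*h+5" using assms by (auto simp: z_def)
  have "(y - x) mod (10*h+5) = (- z) mod (10*h+5)"
    by (simp add: z_def mod_minus_eq)
  then show ?thesis
    using mod_conn_iff[of h z] mod_conn_iff[of h "- z"] assms z by (simp flip: z_def) blast
qed

lemma S_set_eq: "S_set (2*h+3) = {2*h-1, 2*h} \<union> {2*h+4..3*h} \<union> {3*h+2, 4*h+2}"
proof -
  have "(3 * (2*h+3) - 9) div 2 = 3*h" "(3 * (2*h+3) - 5) div 2 = 3*h+2" by simp_all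
  then show ?thesis unfolding S_set_def by (simp add: algebra_simps)
qed

lemma G_graph_eq: "G_graph (2*h+3) = Circ (10*h+5) (S_set (2*h+3))"
proof -
  have "5 * (2*h+3) - 10 = 10*h+5" by simp
  then show ?thesis by (simp only: G_graph_def)
qed

lemma circ_dist_in_S_set:
  assumes "h \<ge> 7"
  shows "circ_dist (10*h+5) x y \<in> S_set (2*h+3) \<longleftrightarrow> (y - x) mod (10*h+5) \<in> conn h"
proof -
  define k where "k = (y - x) mod (10*h+5)"
  have k: "0 \<le> k" "k < 10*h+5" using assms by (auto simp: k_def)
  have low: "z \<in> S_set (2*h+3) \<longleftrightarrow> z \<in> conn h" if "z \<le> 5*h+2" for z
    using that assms unfolding S_set_eq conn_iff by auto
  show ?thesis
  proof (cases "k \<le> 5*h+2")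
    case True
    then show ?thesis using low by (simp add: circ_dist_def Let_def min_def flip: k_def)
  next
    case False
    then show ?thesis using low[of "10*h+5 - k"] conn_reflect[of h k]
      by (simp add: circ_dist_def Let_def min_def flip: k_def)
  qed
qed

lemma vertices_G_graph: "vertices (G_graph (2*h+3)) = {0..<10*h+5}"
  by (simp add: G_graph_eq Circ_def)

lemma edge_G_graph_iff:
  assumes "h \<ge> 7" "x \<in> {0..<10*h+5}" "y \<in> {0..<10*h+5}"
  shows "{x, y} \<in> edges (G_graph (2*h+3)) \<longleftrightarrow> (y - x) mod (10*h+5) \<in> conn h"
  using Circ_adjacent_iff[of "10*h+5" x y "S_set (2*h+3)"] circ_dist_in_S_set assms by (simp add: G_graph_eq)

lemma edge_G_graphE:
  assumes "e \<in> edges (G_graph (2*h+3))"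
  obtains x y where "x \<in> {0..<10*h+5}" "y \<in> {0..<10*h+5}" "e = {x, y}"
  using assms unfolding G_graph_eq Circ_def by auto

lemma indep_G_graph_iff:
  assumes "h \<ge> 7" "I \<subseteq> {0..<10*h+5}"
  shows "indep I (edges (G_graph (2*h+3))) \<longleftrightarrow> (\<forall>x\<in>I. \<forall>y\<in>I. x - y \<notin> conn h)"
proof -
  have "{x, y} \<in> edges (G_graph (2*h+3)) \<longleftrightarrow> x - y \<in> conn h \<or> y - x \<in> conn h" if "x \<in> I" "y \<in> I" for x y
  proof -
    have "x \<in> {0..<10*h+5}" "y \<in> {0..<10*h+5}" using that assms(2) by auto
    then show ?thesis
      using edge_G_graph_iff[of h x y] mod_conn_iff[of h "y - x"] assms(1) by auto
  qed
  moreover have "0 \<notin> conn h" using conn_bounds[of 0 h] assms(1) by auto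
  ultimately show ?thesis unfolding indep_def by (metis diff_self)
qed

lemma indep_card_le:
  assumes h: "h \<ge> 7" and I: "I \<subseteq> {0..<10*h+5}" "indep I (edges (G_graph (2*h+3)))"
  shows "int (card I) \<le> 2*h+2"
proof -
  let ?n = "10*h+5"
  \<comment> \<open>The periodic extension of \<open>I\<close>, to which the bound for periodic sets
    applies.\<close>
  let ?P = "\<lambda>x. x mod ?n \<in> I"
  have no: "a - b \<notin> conn h" if "a \<in> I" "b \<in> I" for a b
    using indep_G_graph_iff[OF h I(1)] I(2) that by blast
  have "x - y \<notin> conn h" if "?P x" "?P y" for x y
  proof
    assume xy: "x - y \<in> conn h"
    have z: "- ?n < x mod ?n - y mod ?n" "x mod ?n - y mod ?n < ?n"
      using pos_mod_bound[of ?n x] pos_mod_sign[of ?n x] pos_mod_bound[of ?n y] pos_mod_sign[of ?n y] h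
      by linarith+
    have "(x mod ?n - y mod ?n) mod ?n = x - y"
      using conn_bounds[OF xy h] by (simp add: mod_diff_eq)
    then show False
      using mod_conn_iff[OF h z] xy no[OF that] no[OF that(2,1)] by simp
  qed
  then have "periodic_indep h ?P" by (simp add: periodic_indep_def)
  moreover have "period_set h ?P = I"
    using I(1) by (auto simp: period_set_def subset_iff)
  ultimately show ?thesis using card_independent_le[of h ?P] h by simp
qed

lemma no_triangle_G_graph:
  assumes h: "h \<ge> 7"
  shows "\<not> has_triangle (G_graph (2*h+3))"
proof
  let ?n = "10*h+5" and ?E = "edges (G_graph (2*h+3))"
  assume "has_triangle (G_graph (2*h+3))"
  then obtain K where K: "K \<subseteq> {0..<?n}" "card K = 3" "clique K ?E"
    unfolding has_clique_def vertices_G_graph by blast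
  then obtain a b c where abc: "K = {a, b, c}" "a \<noteq> b" "b \<noteq> c" "a \<noteq> c"
    by (auto simp: card_3_iff)
  define p q r where "p = (b - a) mod ?n" and "q = (c - b) mod ?n" and "r = (c - a) mod ?n"
  have pqr: "p \<in> conn h" "q \<in> conn h" "r \<in> conn h"
    using K(1,3) abc edge_G_graph_iff[OF h] unfolding clique_def p_def q_def r_def by auto
  have r: "r = (p + q) mod ?n" by (simp add: p_def q_def r_def mod_add_eq)
  show False
  proof (cases "p + q < ?n")
    case True
    then have "r = p + q"
      unfolding r using conn_bounds[OF pqr(1) h] conn_bounds[OF pqr(2) h] by (intro mod_pos_pos_trivial) auto
    then show False using conn_sum_free[OF h pqr(1,2)] pqr(3) by simp
  next
    case False
    have "r = (p + q - ?n) mod ?n" by (simp only: r minus_mod_self2)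
    also have "\<dots> = p + q - ?n"
      using False conn_bounds[OF pqr(1) h] conn_bounds[OF pqr(2) h] by (intro mod_pos_pos_trivial) auto
    \<comment> \<open>When the sum wraps around, reflecting \<open>q\<close> turns the triangle into
      an unreduced sum again.\<close>
    finally have "p = r + (?n - q)" by simp
    then show False using conn_sum_free[OF h pqr(3), of "?n - q"] conn_reflect[of h q] pqr by simp
  qed
qed

lemma add_short_edge_triangle:
  assumes h: "h \<ge> 7" and xy: "x \<in> {0..<10*h+5}" "y \<in> {0..<10*h+5}" "x \<noteq> y"
    "{x, y} \<notin> edges (G_graph (2*h+3))" "(y - x) mod (10*h+5) \<le> 5*h+2"
  shows "has_triangle (add_edge (G_graph (2*h+3)) {x, y})"
proof -
  let ?n = "10*h+5" and ?E = "edges (G_graph (2*h+3))"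
  define d where "d = (y - x) mod ?n"
  have "d \<noteq> 0"
  proof
    assume "d = 0"
    then have "y mod ?n = x mod ?n" by (simp add: d_def mod_eq_dvd_iff mod_eq_0_iff_dvd)
    then show False using xy(1-3) by simp
  qed
  then have d: "0 < d" "d \<le> 5*h+2" using xy(5) h by (auto simp: d_def order_less_le)
  have "d \<notin> conn h"
    using xy(4) edge_G_graph_iff[OF h xy(1,2)] by (simp add: d_def)
  then obtain a where a: "a \<in> conn h" "d - a \<in> conn h \<or> a - d \<in> conn h"
    using common_neighbour[OF h d] by blast
  \<comment> \<open>The common neighbour of 0 and \<open>d\<close>, translated to one of
    \<open>x\<close> and \<open>y\<close>.\<close>
  define z where "z = (x + a) mod ?n"
  have z: "z \<in> {0..<?n}" using h by (simp add: z_def)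
  have "(z - x) mod ?n = a"
    using conn_bounds[OF a(1) h] by (simp add: z_def mod_diff_left_eq)
  then have zx: "{x, z} \<in> ?E" using edge_G_graph_iff[OF h xy(1) z] a by simp
  have "(y - z) mod ?n = (d - a) mod ?n"
    by (simp add: z_def d_def mod_diff_right_eq mod_diff_left_eq algebra_simps)
  moreover have "- ?n < d - a" "d - a < ?n"
    using conn_bounds[OF a(1) h] d h by auto
  ultimately have zy: "{z, y} \<in> ?E"
    using edge_G_graph_iff[OF h z xy(2)] a(2) mod_conn_iff[OF h, of "d - a"] by auto
  have "{v, v} \<notin> ?E" if "v \<in> {0..<?n}" for v
    using edge_G_graph_iff[OF h that that] conn_bounds[of 0 h] h by auto
  then have "z \<noteq> x" "z \<noteq> y" using zx zy xy by auto
  then have "card {x, y, z} = 3" using xy(3) by auto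
  moreover have "clique {x, y, z} (insert {x, y} ?E)"
    using zx zy by (auto simp: clique_def insert_commute)
  ultimately show ?thesis
    unfolding has_clique_def add_edge_def using xy z vertices_G_graph by (intro exI[of _ "{x, y, z}"]) auto
qed

lemma add_edge_triangle_G_graph:
  assumes h: "h \<ge> 7" and e: "e \<in> nonedges (G_graph (2*h+3))"
  shows "has_triangle (add_edge (G_graph (2*h+3)) e)"
proof -
  let ?n = "10*h+5"
  obtain x y where xy: "x \<in> {0..<?n}" "y \<in> {0..<?n}" "x \<noteq> y" "e = {x, y}"
    using e unfolding nonedges_def vertices_G_graph nsets_2_eq by blast
  have ne: "{x, y} \<notin> edges (G_graph (2*h+3))"
    using e unfolding nonedges_def xy(4) by blast
  show ?thesis
  proof (cases "(y - x) mod ?n \<le> 5*h+2")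
    case True
    then show ?thesis using add_short_edge_triangle[OF h xy(1-3) ne] xy(4) by simp
  next
    case False
    have "(x - y) mod ?n = ?n - (y - x) mod ?n"
      using zmod_zminus1_eq_if[of "y - x" ?n] False h by simp
    then have "(x - y) mod ?n \<le> 5*h+2" using False by simp
    moreover have "{y, x} \<notin> edges (G_graph (2*h+3))" using ne by (simp add: insert_commute)
    ultimately show ?thesis
      using add_short_edge_triangle[OF h xy(2,1) xy(3)[symmetric]] unfolding xy(4) by (simp add: insert_commute)
  qed
qed

lemma del_short_edge_indep:
  assumes h: "h \<ge> 7" and xy: "x \<in> {0..<10*h+5}" "y \<in> {0..<10*h+5}"
    "(y - x) mod (10*h+5) \<in> conn h" "(y - x) mod (10*h+5) \<le> 4*h+2"
  shows "has_indep (del_edge (G_graph (2*h+3)) {x, y}) (nat (2*h+3))"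
proof -
  let ?n = "10*h+5" and ?E = "edges (G_graph (2*h+3))"
  define s where "s = (y - x) mod ?n"
  obtain J where J: "J \<subseteq> {0..<?n}" "int (card J) = 2*h+3" "0 \<in> J" "s \<in> J"
      "\<And>i j. i \<in> J \<Longrightarrow> j \<in> J \<Longrightarrow> i - j \<in> conn h \<Longrightarrow> i = s \<and> j = 0"
    using critical_conn[OF h xy(3,4)] unfolding critical_def s_def by blast
  \<comment> \<open>Translation by \<open>x\<close> sends 0 to \<open>x\<close> and \<open>s\<close>
    to \<open>y\<close>, so \<open>{x, y}\<close> is the only edge inside the image of
    \<open>J\<close>.\<close>
  define v where "v i = (x + i) mod ?n" for i
  have v: "v i \<in> {0..<?n}" for i using h by (simp add: v_def)
  have v0: "v 0 = x" using xy(1) by (simp add: v_def)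
  have vs: "v s = y" using xy(2) by (simp add: v_def s_def mod_add_right_eq)
  have "inj_on v J"
  proof (rule inj_onI)
    fix i j assume ij: "i \<in> J" "j \<in> J" "v i = v j"
    then have "(x + i - x) mod ?n = (x + j - x) mod ?n"
      unfolding v_def by (intro mod_diff_cong) auto
    then show "i = j" using ij J(1) by (auto simp: subset_iff)
  qed
  then have card: "card (v ` J) = nat (2*h+3)" using J(2) by (simp add: card_image)
  have "{v i, v j} = {x, y}" if ij: "i \<in> J" "j \<in> J" "{v i, v j} \<in> ?E" for i j
  proof -
    have "(v j - v i) mod ?n = (j - i) mod ?n"
      by (simp add: v_def mod_diff_eq)
    moreover have "- ?n < j - i" "j - i < ?n" using subsetD[OF J(1) ij(1)] subsetD[OF J(1) ij(2)] by auto
    ultimately have "j - i \<in> conn h \<or> i - j \<in> conn h"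
      using ij(3) edge_G_graph_iff[OF h v v] mod_conn_iff[OF h, of "j - i"] by simp
    then have "i = s \<and> j = 0 \<or> j = s \<and> i = 0" using J(5) ij by blast
    then show ?thesis using v0 vs by auto
  qed
  then have "indep (v ` J) (?E - {{x, y}})" unfolding indep_def by blast
  then show ?thesis
    unfolding has_indep_def del_edge_def using card v vertices_G_graph finite_subset[OF J(1)]
    by (intro exI[of _ "v ` J"]) auto
qed

lemma del_edge_indep_G_graph:
  assumes h: "h \<ge> 7" and e: "e \<in> edges (G_graph (2*h+3))"
  shows "has_indep (del_edge (G_graph (2*h+3)) e) (nat (2*h+3))"
proof -
  let ?n = "10*h+5"
  obtain x y where xy: "x \<in> {0..<?n}" "y \<in> {0..<?n}" "e = {x, y}"
    using e by (rule edge_G_graphE)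
  have c: "(y - x) mod ?n \<in> conn h" "(x - y) mod ?n \<in> conn h"
    using e edge_G_graph_iff[OF h xy(1,2)] mod_conn_uminus[OF h, of y x] unfolding xy(3) by simp_all
  show ?thesis
  proof (cases "(y - x) mod ?n \<le> 4*h+2")
    case True
    then show ?thesis using del_short_edge_indep[OF h xy(1,2) c(1)] xy(3) by simp
  next
    case False
    have "(x - y) mod ?n = ?n - (y - x) mod ?n"
      using zmod_zminus1_eq_if[of "y - x" ?n] False h by simp
    \<comment> \<open>The connection set has no element strictly between \<open>4*h+2\<close> and
      \<open>6*h+3\<close>, so the reversed difference is short.\<close>
    moreover have "(y - x) mod ?n \<ge> 6*h+3"
      using c(1) False unfolding conn_iff using h by auto
    ultimately have "(x - y) mod ?n \<le> 4*h+2" by simp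
    then show ?thesis
      using del_short_edge_indep[OF h xy(2,1) c(2)] unfolding xy(3) by (simp only: insert_commute)
  qed
qed

lemma independence_number_G_graph:
  assumes h: "h \<ge> 7"
  shows "int (independence_number (G_graph (2*h+3))) = 2*h+2"
proof -
  let ?n = "10*h+5" and ?E = "edges (G_graph (2*h+3))"
  let ?A = "{card I | I. I \<subseteq> {0..<?n} \<and> indep I ?E}"
  have sub: "conn h \<subseteq> {0..<?n}" using conn_bounds h by fastforce
  \<comment> \<open>The connection set is the neighbourhood of 0, and being sum-free it is
    independent.\<close>
  have "indep (conn h) ?E"
    unfolding indep_G_graph_iff[OF h sub]
  proof (intro ballI notI)
    fix x y assume "x \<in> conn h" "y \<in> conn h" "x - y \<in> conn h"
    then show False using conn_sum_free[OF h, of "x - y" y] by simp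
  qed
  then have mem: "card (conn h) \<in> ?A" using sub by blast
  have "Max ?A = card (conn h)"
  proof (rule Max_eqI)
    have "?A \<subseteq> card ` Pow {0..<?n}" by auto
    then show "finite ?A" by (rule finite_subset) simp
    fix k assume "k \<in> ?A"
    then obtain I where "k = card I" "I \<subseteq> {0..<?n}" "indep I ?E" by blast
    then have "int k \<le> int (card (conn h))" using indep_card_le[OF h] card_conn[OF h] by simp
    then show "k \<le> card (conn h)" by simp
  qed (rule mem)
  then show ?thesis using card_conn[OF h] by (simp add: independence_number_def vertices_G_graph)
qed

theorem theorem1p1:
  fixes t :: int
  assumes "t \<ge> 17" and "odd t"
  shows "doubly_saturated_R_good 3 (nat t) (G_graph t)
    \<and> \<not> has_triangle (G_graph t)
    \<and> int (independence_number (G_graph t)) = t - 1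
    \<and> (\<forall>e \<in> nonedges (G_graph t). has_triangle (add_edge (G_graph t) e))
    \<and> (\<forall>e \<in> edges (G_graph t). has_indep (del_edge (G_graph t) e) (nat t))"
proof -
  obtain k where "t = 2 * k + 1" using assms(2) by (rule oddE)
  then have t: "t = 2 * (k - 1) + 3" by simp
  define h where "h = k - 1"
  have h: "h \<ge> 7" using assms(1) t by (simp add: h_def)
  have t: "t = 2*h+3" using t by (simp add: h_def)
  have "\<not> has_indep (G_graph t) (nat t)"
  proof
    assume "has_indep (G_graph t) (nat t)"
    then obtain I where "I \<subseteq> {0..<10*h+5}" "card I = nat t" "indep I (edges (G_graph (2*h+3)))"
      unfolding has_indep_def t vertices_G_graph by blast
    then show False using indep_card_le[OF h, of I] h t by simp
  qed
  then show ?thesis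
    using no_triangle_G_graph[OF h] add_edge_triangle_G_graph[OF h] del_edge_indep_G_graph[OF h]
      independence_number_G_graph[OF h]
    unfolding doubly_saturated_R_good_def R_good_def t by auto
qed

end
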